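(* Let $k>3$ and let $G$ be a $k$-connected graph of minimum degree at least $\frac{3}{2}k-\frac{3}{2}$. Then every DFS tree of $G$ contains at least two $k$-contractible edges.
   Context: All graphs are finite, simple and undirected. A graph $G$ is $k$-connected ($k\ge 1$) if $|V(G)|>k$ and $G-T$ is connected for every $T\subseteq V(G)$ with $|T|<k$. For an edge $e$, $G/e$ denotes the graph obtained by identifying the two endvertices of $e$ and simplifying. An edge $e$ of a $k$-connected graph $G$ is $k$-contractible if $G/e$ is $k$-connected. A DFS tree of $G$ is a spanning tree $Q$ of $G$ with a prescribed root vertex $r$ such that for every vertex $x$, any two $x$-branches are nonadjacent in $G$, where an $x$-branch is the vertex set of a component of $Q-x$ not containing $r$. *)

theory Defs
  imports Complex_Main "Graph_Theory.Graph_Theory"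
begin

text \<open>
  Finite simple undirected graphs are the library's \<open>pair_graph\<close>s: finite, loop-free and
  symmetric, so that an undirected edge \<open>{u, v}\<close> is the pair of arcs \<open>(u, v)\<close> and \<open>(v, u)\<close>.
  The degree of a vertex is therefore its out-degree.
\<close>

definition uedges :: "'a pair_pre_digraph \<Rightarrow> 'a set set" where
  "uedges G = {{u, v} | u v. (u, v) \<in> parcs G}"

definition min_degree :: "'a pair_pre_digraph \<Rightarrow> nat" where
  "min_degree G = Min (out_degree (with_proj G) ` pverts G)"

definition k_connected :: "nat \<Rightarrow> 'a pair_pre_digraph \<Rightarrow> bool" where
  "k_connected k G \<longleftrightarrow> card (pverts G) > k \<and>
     (\<forall>T \<subseteq> pverts G. card T < k \<longrightarrow> connected (with_proj G \<restriction> (pverts G - T)))"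

text \<open>
  Identifying the ends of \<open>e\<close>: the vertices of \<open>G/e\<close> are the classes of the partition of the
  vertex set into \<open>e\<close> and singletons. Arcs within a class are dropped, and parallel arcs
  coincide because arcs are pairs, so the result is simple.
\<close>

definition contract_class :: "'a set \<Rightarrow> 'a \<Rightarrow> 'a set" where
  "contract_class e v = (if v \<in> e then e else {v})"

definition contract :: "'a pair_pre_digraph \<Rightarrow> 'a set \<Rightarrow> 'a set pair_pre_digraph" where
  "contract G e = \<lparr> pverts = contract_class e ` pverts G,
     parcs = {(contract_class e u, contract_class e v) | u v.
       (u, v) \<in> parcs G \<and> contract_class e u \<noteq> contract_class e v} \<rparr>"

lemma pair_graph_contract:
  assumes "pair_graph G"
  shows "pair_graph (contract G e)"
proof -
  interpret pair_graph G by fact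
  have "parcs (contract G e) \<subseteq> (\<lambda>(u, v). (contract_class e u, contract_class e v)) ` parcs G"
    by (auto simp: contract_def)
  then have "finite (parcs (contract G e))"
    using pair_finite_arcs by (meson finite_imageI finite_subset)
  then show ?thesis
    using pair_finite_verts
    by unfold_locales
      (auto simp: contract_def symmetric_def sym_def
        intro: in_arcsD1 in_arcsD2 arcs_symmetric)
qed

definition k_contractible :: "nat \<Rightarrow> 'a pair_pre_digraph \<Rightarrow> 'a set \<Rightarrow> bool" where
  "k_contractible k G e \<longleftrightarrow> e \<in> uedges G \<and> k_connected k (contract G e)"

text \<open>
  The library's \<open>forest\<close> and \<open>tree\<close> are meant for oriented graphs: in a symmetric graph, going
  along an edge and back is a \<open>cycle\<close> of length 2. Undirected cycles are those of length at
  least 3.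
\<close>

definition spanning_utree :: "'a pair_pre_digraph \<Rightarrow> 'a pair_pre_digraph \<Rightarrow> bool" where
  "spanning_utree Q G \<longleftrightarrow> pair_graph Q \<and> spanning (with_proj Q) (with_proj G) \<and>
     connected (with_proj Q) \<and> \<not> (\<exists>p. pre_digraph.cycle (with_proj Q) p \<and> length p \<ge> 3)"

text \<open>
  Strongly connected components of a symmetric graph are its connected components.
\<close>

definition branches :: "'a pair_pre_digraph \<Rightarrow> 'a \<Rightarrow> 'a \<Rightarrow> 'a set set" where
  "branches Q r x =
     {B \<in> pre_digraph.sccs_verts (with_proj Q \<restriction> (pverts Q - {x})). r \<notin> B}"

definition dfs_tree :: "'a pair_pre_digraph \<Rightarrow> 'a \<Rightarrow> 'a pair_pre_digraph \<Rightarrow> bool" where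
  "dfs_tree Q r G \<longleftrightarrow> spanning_utree Q G \<and> r \<in> pverts G \<and>
     (\<forall>x \<in> pverts G. \<forall>A \<in> branches Q r x. \<forall>B \<in> branches Q r x.
        A \<noteq> B \<longrightarrow> \<not> (\<exists>u \<in> A. \<exists>v \<in> B. (u, v) \<in> parcs G))"

end

theory Submission
  imports Defs
begin

text \<open>
  A non-contractible edge lies inside a separator \<open>T\<close> of \<open>k\<close> vertices; a union \<open>F\<close> of some, but not
  all, components of \<open>G - T\<close> is a fragment, and the degree bound gives \<open>2|F| + 1 \<ge> k\<close>. Take a
  fragment \<open>A\<close> that is minimal among those whose separator spans a tree edge. If a
  non-contractible tree edge \<open>xy\<close> leaves \<open>A\<close>, crossing \<open>A\<close> with a separator through \<open>xy\<close> leaves no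
  slack in any count: \<open>2|A| + 1 = k\<close>, \<open>A\<close> is a clique completely joined to its separator, and the
  separator minus \<open>y\<close> splits into two halves of size \<open>|A|\<close>. Call \<open>A\<close> bad if no contractible tree edge
  leaves it. If the two sides of some separator both contained minimal fragments that are not bad,
  there would be two contractible edges. Otherwise some side of a separator through a tree edge
  leaving a bad fragment contains bad ones only. Making this side as small as possible forces a
  ring-like structure: two adjacent cliques \<open>M, M'\<close>, each of them joined to a bad clique and to one
  further vertex, through which all other tree edges leave. No depth-first tree can look like that,
  because the ends of every edge of \<open>G\<close> are comparable in the tree order.
\<close>

section \<open>Fragments and crossing separators\<close>

definition nbhd :: "'a rel \<Rightarrow> 'a set \<Rightarrow> 'a set" where
  "nbhd E F = E `` F - F"

text \<open>Here \<open>a\<close>, \<open>t\<close>, \<open>c\<close> count the cells in the rows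
  \<open>A\<close>, \<open>N A\<close>, \<open>co A\<close>, and the indices 1, 2, 3 stand for the
  columns \<open>B\<close>, \<open>N B\<close>, \<open>co B\<close>. The sets surrounding two
  opposite corners have \<open>2 * k\<close> elements in total, so a corner of \<open>A\<close>
  surrounded by more than \<open>k\<close> forces the opposite corner of \<open>co A\<close> to be
  empty.\<close>

lemma crossing_end_arith:
  fixes a1 a2 a3 t1 t2 t3 c1 c2 c3 :: nat
  assumes sums: "t1 + t2 + t3 = k" "a2 + t2 + c2 = k"
    and sizes: "k \<le> 2 * (a1 + a2 + a3) + 1" "k \<le> 2 * (c1 + c2 + c3) + 1"
      "k \<le> 2 * (a1 + t1 + c1) + 1" "k \<le> 2 * (a3 + t3 + c3) + 1"
    and c: "c1 = 0 \<or> k \<le> c2 + t2 + t1" "c3 = 0 \<or> k \<le> c2 + t2 + t3"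
    and a: "a1 = 0 \<or> k < a2 + t2 + t1" "a3 = 0 \<or> k < a2 + t2 + t3"
    and t2: "t2 > 0"
  shows "a1 = 0 \<and> a3 = 0 \<and> 2 * a2 + 1 = k \<and> t2 = 1 \<and> 2 * t1 + 1 = k \<and> 2 * t3 + 1 = k"
proof -
  note sizes = sizes[unfolded add_mult_distrib2]
  have 1: "a1 = 0"
  proof (rule ccontr)
    assume "a1 \<noteq> 0"
    with a have a1: "k < a2 + t2 + t1" by blast
    have c3: "c3 = 0" using c(2) a1 sums by linarith
    show False
    proof (cases "a3 = 0")
      case True
      then show False using c(1) a1 c3 sums sizes t2 by (elim disjE; linarith)
    next
      case False
      with a have a3: "k < a2 + t2 + t3" by blast
      then have "c1 = 0" using c(1) sums by linarith
      then show False using c3 a1 a3 sums sizes t2 by linarith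
    qed
  qed
  have 2: "a3 = 0"
  proof (rule ccontr)
    assume "a3 \<noteq> 0"
    with a have a3: "k < a2 + t2 + t3" by blast
    have "c1 = 0" using c(1) a3 sums by linarith
    then show False using 1 c(2) a3 sums sizes t2 by (elim disjE; linarith)
  qed
  have t1: "2 * t1 + 1 \<ge> k" using c(1) sums sizes 1 2 by (elim disjE; linarith)
  have t3: "2 * t3 + 1 \<ge> k" using c(2) sums sizes 1 2 by (elim disjE; linarith)
  have "2 * a2 + 1 \<ge> k" using sizes 1 2 by linarith
  moreover have "2 * t1 + 1 \<le> k" "2 * t3 + 1 \<le> k" "t2 \<le> 1" using t1 t3 sums t2 by linarith+
  moreover have "2 * a2 + 1 \<le> k"
  proof (cases "c1 = 0 \<and> c3 = 0")
    case True
    then show ?thesis using sums sizes t2 by linarith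
  next
    case False
    then have "k \<le> c2 + t2 + t1 \<or> k \<le> c2 + t2 + t3" using c by blast
    then show ?thesis using sums calculation by (elim disjE; linarith)
  qed
  ultimately show ?thesis using 1 2 t1 t3 t2 by linarith
qed

text \<open>\<open>separator\<close> is k-connectedness in terms of neighbourhoods;
  \<open>degree\<close> is the bound 3k/2 - 3/2 cleared of fractions.\<close>

locale dense_kconn =
  fixes V :: "'a set" and E :: "'a rel" and k :: nat
  assumes finV: "finite V"
    and EV: "E \<subseteq> V \<times> V"
    and symE: "sym E"
    and irreflE: "irrefl E"
    and separator: "F \<subseteq> V \<Longrightarrow> F \<noteq> {} \<Longrightarrow> F \<union> nbhd E F \<noteq> V \<Longrightarrow> k \<le> card (nbhd E F)"
    and degree: "v \<in> V \<Longrightarrow> 3 * k \<le> 2 * card (E `` {v}) + 3"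
    and k_gt: "k > 3"
begin

abbreviation N :: "'a set \<Rightarrow> 'a set" where
  "N \<equiv> nbhd E"

definition fragment :: "'a set \<Rightarrow> bool" where
  "fragment F \<longleftrightarrow> F \<subseteq> V \<and> F \<noteq> {} \<and> F \<union> N F \<noteq> V \<and> card (N F) = k"

definition co :: "'a set \<Rightarrow> 'a set" where
  "co F = V - F - N F"

text \<open>The smallest size that \<open>card_fragment\<close> permits.\<close>

definition full :: "'a set \<Rightarrow> bool" where
  "full F \<longleftrightarrow> fragment F \<and> 2 * card F + 1 = k"

section \<open>Neighbourhoods and the two sides of a fragment\<close>

lemma E_sym: "(u, v) \<in> E \<Longrightarrow> (v, u) \<in> E"
  using symE by (auto dest: symD)

lemma E_neq: "(u, v) \<in> E \<Longrightarrow> u \<noteq> v"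
  using irreflE by (auto simp: irrefl_def)

lemma E_V: "(u, v) \<in> E \<Longrightarrow> u \<in> V \<and> v \<in> V"
  using EV by auto

lemma N_subset: "N F \<subseteq> V"
  using EV by (auto simp: nbhd_def)

lemma N_disjoint: "F \<inter> N F = {}"
  by (auto simp: nbhd_def)

lemma N_I: "(u, v) \<in> E \<Longrightarrow> u \<in> F \<Longrightarrow> v \<notin> F \<Longrightarrow> v \<in> N F"
  by (auto simp: nbhd_def)

lemma N_E:
  assumes "v \<in> N F" obtains u where "u \<in> F" "(u, v) \<in> E" "v \<notin> F"
  using assms by (auto simp: nbhd_def)

lemma co_subset: "co F \<subseteq> V" by (auto simp: co_def)

lemma fin: "X \<subseteq> V \<Longrightarrow> finite X"
  using finV finite_subset by blast

lemma fragmentD: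
  assumes "fragment F"
  shows "F \<subseteq> V" "F \<noteq> {}" "card (N F) = k" "co F \<noteq> {}"
  using assms N_subset[of F] by (auto simp: fragment_def co_def)

lemma no_edge_co: "u \<in> F \<Longrightarrow> v \<in> co F \<Longrightarrow> (u, v) \<notin> E"
  by (auto simp: co_def nbhd_def)

text \<open>No edge joins \<open>F\<close> to \<open>co F\<close>, so \<open>N (co F)\<close> lies
  in \<open>N F\<close>; being a separator itself, it has at least \<open>k\<close> elements and
  hence is all of \<open>N F\<close>.\<close>

lemma N_co:
  assumes "fragment F" shows "N (co F) = N F"
proof -
  have sub: "N (co F) \<subseteq> N F"
  proof
    fix v assume "v \<in> N (co F)"
    then obtain u where u: "u \<in> co F" "(u, v) \<in> E" "v \<notin> co F" by (rule N_E)
    then have "v \<notin> F" using no_edge_co E_sym by blast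
    then show "v \<in> N F" using u E_V by (auto simp: co_def)
  qed
  have "co F \<union> N (co F) \<noteq> V"
    using sub fragmentD[OF assms] N_disjoint[of F] by (auto simp: co_def)
  then have "k \<le> card (N (co F))"
    using separator[OF co_subset fragmentD(4)[OF assms]] by blast
  then show ?thesis
    using sub fragmentD(3)[OF assms] by (metis card_seteq fin N_subset)
qed

lemma co_co:
  assumes "fragment F" shows "co (co F) = F"
  using fragmentD[OF assms] N_disjoint[of F] N_subset[of F]
  unfolding co_def[of "co F"] N_co[OF assms] by (auto simp: co_def)

lemma fragment_co:
  assumes "fragment F" shows "fragment (co F)"
  using fragmentD[OF assms] N_disjoint[of F] co_subset
  unfolding fragment_def N_co[OF assms] by (auto simp: co_def)

section \<open>Sizes of fragments, and full fragments as cliques\<close>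

lemma E_image_fragment:
  assumes "v \<in> F" shows "E `` {v} \<subseteq> (F - {v}) \<union> N F"
  using assms by (auto simp: nbhd_def dest: E_neq)

text \<open>The neighbours of a vertex of \<open>F\<close> lie in the rest of \<open>F\<close> and
  in \<open>N F\<close>, so its degree is at most \<open>card F - 1 + k\<close>; compare with the
  degree bound.\<close>

lemma card_fragment:
  assumes "fragment F" shows "k \<le> 2 * card F + 1"
proof -
  note F = fragmentD[OF assms]
  obtain v where v: "v \<in> F" using F by auto
  have "card (E `` {v}) \<le> card ((F - {v}) \<union> N F)"
    using E_image_fragment[OF v] fin[OF F(1)] fin[OF N_subset] by (intro card_mono) auto
  also have "\<dots> \<le> card (F - {v}) + k" using card_Un_le F(3) by metis
  also have "card (F - {v}) = card F - 1" using v by simp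
  finally have "card (E `` {v}) \<le> card F - 1 + k" .
  moreover have "card F \<ge> 1" using v fin[OF F(1)] by (metis One_nat_def Suc_leI card_gt_0_iff empty_iff)
  moreover have "3 * k \<le> 2 * card (E `` {v}) + 3" using degree v F(1) by auto
  ultimately show ?thesis by linarith
qed

text \<open>Equality in the count behind \<open>card_fragment\<close>: a full fragment is a clique
  completely joined to its separator.\<close>

lemma full_adj:
  assumes "full F" "v \<in> F" shows "E `` {v} = (F - {v}) \<union> N F"
proof -
  have fr: "fragment F" and c: "2 * card F + 1 = k" using assms by (auto simp: full_def)
  note F = fragmentD[OF fr]
  have f: "finite (F - {v} \<union> N F)" using fin[OF F(1)] fin[OF N_subset] by auto
  have "card ((F - {v}) \<union> N F) \<le> card (F - {v}) + k" using card_Un_le F(3) by metis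
  moreover have "card (F - {v}) = card F - 1" using assms by simp
  moreover have "3 * k \<le> 2 * card (E `` {v}) + 3" using degree assms(2) F(1) by auto
  moreover have "card F \<ge> 1"
    using assms(2) fin[OF F(1)] by (metis One_nat_def Suc_leI card_gt_0_iff empty_iff)
  ultimately have "card ((F - {v}) \<union> N F) \<le> card (E `` {v})" using c by linarith
  then show ?thesis using card_seteq[OF f E_image_fragment[OF assms(2)]] by simp
qed

lemma full_adjI:
  assumes "full F" "v \<in> F" "w \<in> F \<union> N F" "w \<noteq> v" shows "(v, w) \<in> E"
  using full_adj[OF assms(1,2)] assms by auto

lemma N_fragment_adj:
  assumes "fragment F" "v \<in> N F" obtains w where "w \<in> co F" "(v, w) \<in> E"
  using assms N_co by (metis N_E E_sym)

lemma fullD: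
  assumes "full F"
  shows "fragment F" "2 * card F + 1 = k" "card F \<ge> 2"
  using assms k_gt by (auto simp: full_def)

text \<open>A common vertex has closed neighbourhood \<open>A \<union> N A\<close> and also
  \<open>C \<union> N C\<close>. A vertex of \<open>C\<close> in \<open>N A\<close> would have a
  neighbour in \<open>co A\<close>, outside this set; so \<open>C \<subseteq> A\<close>, and the
  sizes agree.\<close>

lemma full_eq:
  assumes A: "full A" and C: "full C" and meet: "A \<inter> C \<noteq> {}"
  shows "A = C"
proof -
  obtain v where v: "v \<in> A" "v \<in> C" using meet by auto
  have "insert v (E `` {v}) = A \<union> N A" using full_adj[OF A v(1)] v by auto
  moreover have "insert v (E `` {v}) = C \<union> N C" using full_adj[OF C v(2)] v by auto
  ultimately have eq: "A \<union> N A = C \<union> N C" by simp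
  have "C \<subseteq> A"
  proof
    fix u assume u: "u \<in> C"
    show "u \<in> A"
    proof (rule ccontr)
      assume "u \<notin> A"
      then have "u \<in> N A" using u eq by auto
      then obtain w where "w \<in> co A" "(u, w) \<in> E" using N_fragment_adj fullD[OF A] by metis
      moreover have "w \<in> C \<union> N C" using full_adj[OF C u] \<open>(u, w) \<in> E\<close> by auto
      ultimately show False using eq by (auto simp: co_def)
    qed
  qed
  moreover have "card C = card A" using fullD(2)[OF A] fullD(2)[OF C] by simp
  ultimately show ?thesis
    using card_subset_eq[OF fin[OF fragmentD(1)[OF fullD(1)[OF A]]]] by metis
qed

text \<open>One edge is enough: each of its ends lies in the separator of the other fragment and is
  therefore joined to all of that fragment.\<close>

lemma full_adjacent:
  assumes A: "full A" and C: "full C" and "A \<inter> N C \<noteq> {}"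
  shows "A \<subseteq> N C" "C \<subseteq> N A"
proof -
  obtain a c where ac: "a \<in> A" "a \<in> N C" "c \<in> C" "(c, a) \<in> E"
    using assms by (meson N_E disjoint_iff)
  have ne: "A \<inter> C = {}" using full_eq[OF A C] ac N_disjoint[of C] by auto
  then have c: "c \<in> N A" using ac by (auto intro!: N_I[of a c] E_sym)
  have "(c, a') \<in> E" if "a' \<in> A" for a'
    using full_adjI[OF A that, of c] c ac ne that by (auto intro: E_sym)
  then show "A \<subseteq> N C" using ac ne by (auto intro: N_I)
  have "(a, c') \<in> E" if "c' \<in> C" for c'
    using full_adjI[OF C that, of a] ac ne that by (auto intro: E_sym)
  then show "C \<subseteq> N A" using ac ne by (auto intro: N_I)
qed

lemma full_nonadjacent_sym:
  assumes A: "full A" and C: "full C" and "A \<inter> N C = {}" shows "C \<inter> N A = {}"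
  using full_adjacent[OF C A] fragmentD(2)[OF fullD(1)[OF A]] assms(3) by auto

text \<open>A clique that avoids a separator cannot have vertices on both of its sides.\<close>

lemma full_side:
  assumes A: "full A" and D: "fragment D" and "A \<inter> N D = {}"
  shows "A \<subseteq> D \<or> A \<subseteq> co D"
proof (rule ccontr)
  assume "\<not> ?thesis"
  moreover have "A \<subseteq> D \<union> co D" using fragmentD(1)[OF fullD(1)[OF A]] assms(3) by (auto simp: co_def)
  ultimately obtain a b where "a \<in> A" "a \<in> D" "b \<in> A" "b \<in> co D" by blast
  moreover have "a \<noteq> b" using calculation by (auto simp: co_def)
  ultimately show False using full_adjI[OF A, of a b] no_edge_co by auto
qed

section \<open>Crossing fragments and their corners\<close>

lemma card_split:
  assumes "X \<subseteq> V"
  shows "card X = card (X \<inter> B) + card (X \<inter> N B) + card (X \<inter> co B)"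
proof -
  have "X = (X \<inter> B) \<union> (X \<inter> N B) \<union> (X \<inter> co B)" using assms by (auto simp: co_def)
  moreover have f: "finite X" using fin assms by auto
  ultimately have "card X = card ((X \<inter> B) \<union> (X \<inter> N B)) + card (X \<inter> co B)"
    using card_Un_disjoint[of "(X \<inter> B) \<union> (X \<inter> N B)" "X \<inter> co B"] by (auto simp: co_def)
  also have "card ((X \<inter> B) \<union> (X \<inter> N B)) = card (X \<inter> B) + card (X \<inter> N B)"
    using f N_disjoint[of B] by (intro card_Un_disjoint) auto
  finally show ?thesis .
qed

lemma N_corner: "N (A \<inter> B) \<subseteq> (A \<inter> N B) \<union> (N A \<inter> N B) \<union> (N A \<inter> B)"
  by (auto simp: nbhd_def)

lemma card_corner:
  "card ((A \<inter> N B) \<union> (N A \<inter> N B) \<union> (N A \<inter> B)) =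
   card (A \<inter> N B) + card (N A \<inter> N B) + card (N A \<inter> B)"
proof -
  have f: "finite (N A)" "finite (N B)" using fin N_subset by auto
  have "card ((A \<inter> N B) \<union> (N A \<inter> N B) \<union> (N A \<inter> B)) =
    card ((A \<inter> N B) \<union> (N A \<inter> N B)) + card (N A \<inter> B)"
    using f N_disjoint[of B] by (intro card_Un_disjoint) auto
  also have "card ((A \<inter> N B) \<union> (N A \<inter> N B)) = card (A \<inter> N B) + card (N A \<inter> N B)"
    using f N_disjoint[of A] by (intro card_Un_disjoint) auto
  finally show ?thesis .
qed

lemma corner_ne:
  assumes "fragment A" shows "A \<inter> B \<union> N (A \<inter> B) \<noteq> V"
proof -
  have "A \<inter> B \<union> N (A \<inter> B) \<subseteq> A \<union> N A" by (auto simp: nbhd_def)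
  then show ?thesis using assms fragmentD(1)[OF assms] N_subset[of A] by (auto simp: fragment_def)
qed

lemma corner_ge:
  assumes "fragment A" "A \<inter> B \<noteq> {}"
  shows "k \<le> card (A \<inter> N B) + card (N A \<inter> N B) + card (N A \<inter> B)"
proof -
  have "k \<le> card (N (A \<inter> B))"
    using separator[of "A \<inter> B"] assms fragmentD(1)[OF assms(1)] corner_ne by blast
  also have "\<dots> \<le> card ((A \<inter> N B) \<union> (N A \<inter> N B) \<union> (N A \<inter> B))"
    using N_corner fin N_subset by (intro card_mono) auto
  finally show ?thesis unfolding card_corner .
qed

text \<open>\<open>N (A \<inter> B)\<close> lies in the displayed union and has at least
  \<open>k\<close> elements; if the union has at most \<open>k\<close>, the two coincide.\<close>

lemma corner_fragment:
  assumes "fragment A" "A \<inter> B \<noteq> {}"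
    and "card (A \<inter> N B) + card (N A \<inter> N B) + card (N A \<inter> B) \<le> k"
  shows "fragment (A \<inter> B)" "N (A \<inter> B) = (A \<inter> N B) \<union> (N A \<inter> N B) \<union> (N A \<inter> B)"
proof -
  have ge: "k \<le> card (N (A \<inter> B))"
    using separator[of "A \<inter> B"] assms fragmentD(1)[OF assms(1)] corner_ne by blast
  have f: "finite ((A \<inter> N B) \<union> (N A \<inter> N B) \<union> (N A \<inter> B))" using fin N_subset by auto
  show eq: "N (A \<inter> B) = (A \<inter> N B) \<union> (N A \<inter> N B) \<union> (N A \<inter> B)"
    using card_seteq[OF f N_corner] ge assms(3) unfolding card_corner by linarith
  have "card (N (A \<inter> B)) \<le> k" using assms(3) unfolding eq card_corner .
  then show "fragment (A \<inter> B)"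
    using ge assms fragmentD(1)[OF assms(1)] corner_ne[OF assms(1)] by (auto simp: fragment_def)
qed

text \<open>The counts of the three-by-three table formed by the two partitions. Corner bounds are
  stated for \<open>co A\<close> only; those for \<open>A\<close> will be strict and come from
  minimality of \<open>A\<close>.\<close>

lemma crossing_cells:
  assumes A: "fragment A" and B: "fragment B"
  shows "card (N A \<inter> B) + card (N A \<inter> N B) + card (N A \<inter> co B) = k"
    and "card (A \<inter> N B) + card (N A \<inter> N B) + card (co A \<inter> N B) = k"
    and "card A = card (A \<inter> B) + card (A \<inter> N B) + card (A \<inter> co B)"
    and "card (co A) = card (co A \<inter> B) + card (co A \<inter> N B) + card (co A \<inter> co B)"
    and "card B = card (A \<inter> B) + card (N A \<inter> B) + card (co A \<inter> B)"
    and "card (co B) = card (A \<inter> co B) + card (N A \<inter> co B) + card (co A \<inter> co B)"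
    and "k \<le> 2 * card A + 1" "k \<le> 2 * card (co A) + 1" "k \<le> 2 * card B + 1" "k \<le> 2 * card (co B) + 1"
    and "card (co A \<inter> B) = 0 \<or> k \<le> card (co A \<inter> N B) + card (N A \<inter> N B) + card (N A \<inter> B)"
    and "card (co A \<inter> co B) = 0 \<or> k \<le> card (co A \<inter> N B) + card (N A \<inter> N B) + card (N A \<inter> co B)"
proof -
  note cA = fragment_co[OF A] and cB = fragment_co[OF B]
  show "card (N A \<inter> B) + card (N A \<inter> N B) + card (N A \<inter> co B) = k"
    using card_split[OF N_subset, of A B] fragmentD(3)[OF A] by simp
  show "card (A \<inter> N B) + card (N A \<inter> N B) + card (co A \<inter> N B) = k"
    using card_split[OF N_subset, of B A] fragmentD(3)[OF B] by (simp add: Int_commute)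
  show "card A = card (A \<inter> B) + card (A \<inter> N B) + card (A \<inter> co B)"
    using card_split fragmentD(1)[OF A] by blast
  show "card (co A) = card (co A \<inter> B) + card (co A \<inter> N B) + card (co A \<inter> co B)"
    using card_split co_subset by blast
  show "card B = card (A \<inter> B) + card (N A \<inter> B) + card (co A \<inter> B)"
    using card_split[of B A] fragmentD(1)[OF B] by (simp add: Int_commute)
  show "card (co B) = card (A \<inter> co B) + card (N A \<inter> co B) + card (co A \<inter> co B)"
    using card_split[OF co_subset, of B A] by (simp add: Int_commute)
  show "k \<le> 2 * card A + 1" "k \<le> 2 * card (co A) + 1" "k \<le> 2 * card B + 1"
    "k \<le> 2 * card (co B) + 1"
    using card_fragment A B cA cB by auto
  show "card (co A \<inter> B) = 0 \<or> k \<le> card (co A \<inter> N B) + card (N A \<inter> N B) + card (N A \<inter> B)"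
    using corner_ge[OF cA, of B] unfolding N_co[OF A] by (cases "co A \<inter> B = {}") simp_all
  show "card (co A \<inter> co B) = 0 \<or>
    k \<le> card (co A \<inter> N B) + card (N A \<inter> N B) + card (N A \<inter> co B)"
    using corner_ge[OF cA, of "co B"] unfolding N_co[OF A] N_co[OF B]
    by (cases "co A \<inter> co B = {}") simp_all
qed

text \<open>A nonempty corner of \<open>A\<close> surrounded by at most \<open>k\<close> vertices
  would be a smaller fragment with \<open>x\<close> and \<open>y\<close> in its separator. So the
  bounds for the corners of \<open>A\<close> are strict, and \<open>crossing_end_arith\<close> fixes
  the sizes.\<close>

lemma crossing_end:
  assumes A: "fragment A" and B: "fragment B"
    and x: "x \<in> A" "x \<in> N B" and y: "y \<in> N A" "y \<in> N B"
    and min: "\<And>F. fragment F \<Longrightarrow> F \<subset> A \<Longrightarrow> x \<in> N F \<Longrightarrow> y \<in> N F \<Longrightarrow> False"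
  shows "full A" "A \<subseteq> N B" "N A \<inter> N B = {y}"
    "2 * card (N A \<inter> B) + 1 = k" "2 * card (N A \<inter> co B) + 1 = k"
proof -
  note cells = crossing_cells[OF A B]
  have AV: "A \<subseteq> V" by (rule fragmentD(1)[OF A])
  have corner: "card (A \<inter> D) = 0 \<or> k < card (A \<inter> N D) + card (N A \<inter> N D) + card (N A \<inter> D)"
    if D: "fragment D" "x \<in> N D" "y \<in> N D" for D
  proof (rule ccontr)
    assume neg: "\<not> ?thesis"
    then have ne: "A \<inter> D \<noteq> {}" by force
    from neg have "card (A \<inter> N D) + card (N A \<inter> N D) + card (N A \<inter> D) \<le> k" by linarith
    note c = corner_fragment[OF A ne this]
    have "x \<notin> D" using D(2) N_disjoint[of D] by blast
    then have "A \<inter> D \<subset> A" using x(1) by blast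
    moreover have "x \<in> N (A \<inter> D)" "y \<in> N (A \<inter> D)" unfolding c(2) using x y D by blast+
    ultimately show False by (rule min[OF c(1)])
  qed
  have pos: "card (N A \<inter> N B) > 0"
    using y fin[OF N_subset] by (auto simp: card_gt_0_iff)
  have *: "card (A \<inter> B) = 0 \<and> card (A \<inter> co B) = 0 \<and> 2 * card (A \<inter> N B) + 1 = k \<and>
    card (N A \<inter> N B) = 1 \<and> 2 * card (N A \<inter> B) + 1 = k \<and> 2 * card (N A \<inter> co B) + 1 = k"
    using crossing_end_arith[OF cells(1,2) cells(7-10)[unfolded cells(3-6)] cells(11,12)
        corner[OF B x(2) y(2)] corner[OF fragment_co[OF B], unfolded N_co[OF B], OF x(2) y(2)]
        pos(1)] .
  then have "A \<inter> B = {}" "A \<inter> co B = {}" using fin[OF AV] by auto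
  then have AN: "A \<subseteq> N B" using AV by (auto simp: co_def)
  moreover have "A \<inter> N B = A" using AN by auto
  moreover from * obtain z where "N A \<inter> N B = {z}" by (meson card_1_singletonE)
  then have "N A \<inter> N B = {y}" using y by (metis IntI singletonD)
  ultimately show "full A" "A \<subseteq> N B" "N A \<inter> N B = {y}"
    "2 * card (N A \<inter> B) + 1 = k" "2 * card (N A \<inter> co B) + 1 = k"
    using A * by (auto simp: full_def)
qed

end

section \<open>Depth-first trees\<close>

text \<open>Reachability outside \<open>S\<close>. As a reflexive closure it also relates each
  vertex of \<open>S\<close> to itself, and to nothing else.\<close>

definition reach :: "'a rel \<Rightarrow> 'a set \<Rightarrow> 'a rel" where
  "reach Q S = {(u, v) \<in> Q. u \<notin> S \<and> v \<notin> S}\<^sup>*"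

text \<open>For symmetric \<open>Q\<close> and \<open>X\<close> disjoint from \<open>S\<close>, this
  says that \<open>X\<close> is a union of components of \<open>Q\<close> without
  \<open>S\<close>.\<close>

definition closed_off :: "'a rel \<Rightarrow> 'a set \<Rightarrow> 'a set \<Rightarrow> bool" where
  "closed_off Q S X \<longleftrightarrow> (\<forall>u v. (u, v) \<in> Q \<longrightarrow> u \<in> X \<longrightarrow> v \<in> X \<union> S)"

lemma reach_refl [simp]: "(a, a) \<in> reach Q S"
  by (simp add: reach_def)

lemma reach_trans: "(a, b) \<in> reach Q S \<Longrightarrow> (b, c) \<in> reach Q S \<Longrightarrow> (a, c) \<in> reach Q S"
  unfolding reach_def by (rule rtrancl_trans)

lemma reach_step:
  "(a, b) \<in> reach Q S \<Longrightarrow> (b, c) \<in> Q \<Longrightarrow> b \<notin> S \<Longrightarrow> c \<notin> S \<Longrightarrow> (a, c) \<in> reach Q S"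
  unfolding reach_def by (auto intro: rtrancl_into_rtrancl)

lemma reach_edge: "(a, b) \<in> Q \<Longrightarrow> a \<notin> S \<Longrightarrow> b \<notin> S \<Longrightarrow> (a, b) \<in> reach Q S"
  by (rule reach_step[OF reach_refl])

lemma reach_sym:
  assumes "sym Q" "(a, b) \<in> reach Q S" shows "(b, a) \<in> reach Q S"
proof -
  have "sym {(u, v) \<in> Q. u \<notin> S \<and> v \<notin> S}" using assms(1) by (auto simp: sym_def)
  then show ?thesis using assms(2) unfolding reach_def by (meson sym_rtrancl symD)
qed

lemma reach_empty: "reach Q {} = Q\<^sup>*"
  by (simp add: reach_def)

lemma reach_induct [consumes 1, case_names refl step]:
  assumes "(a, b) \<in> reach Q S" "P a"
    and "\<And>x y. (a, x) \<in> reach Q S \<Longrightarrow> (x, y) \<in> Q \<Longrightarrow> x \<notin> S \<Longrightarrow> y \<notin> S \<Longrightarrow> P x \<Longrightarrow> P y"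
  shows "P b"
  using assms unfolding reach_def by (induction rule: rtrancl_induct) auto

lemma reach_closed:
  assumes "(a, b) \<in> reach Q S" "a \<in> X" "closed_off Q S X" shows "b \<in> X"
  using assms by (induction rule: reach_induct) (auto simp: closed_off_def)

lemma reach_isolated: "(a, d) \<in> reach Q S \<Longrightarrow> d \<in> S \<Longrightarrow> a = d"
  by (induction rule: reach_induct) auto

text \<open>Every vertex of a walk from \<open>a\<close> is reachable from \<open>a\<close>, so the
  walk misses the unreachable set \<open>T\<close>.\<close>

lemma reach_avoid:
  assumes "(a, b) \<in> reach Q S" "\<And>u. u \<in> T \<Longrightarrow> (a, u) \<notin> reach Q S"
  shows "(a, b) \<in> reach Q T"
  using assms(1) by (induction rule: reach_induct) (use assms(2) in \<open>auto intro: reach_step\<close>)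

lemma first_arrival:
  assumes "(a, d) \<in> reach Q S" "a \<noteq> d"
  obtains p where "(a, p) \<in> reach Q (insert d S)" "(p, d) \<in> Q" "p \<noteq> d"
proof -
  have "(a, b) \<in> reach Q (insert d S) \<and> b \<noteq> d \<or> (\<exists>p. (a, p) \<in> reach Q (insert d S) \<and> (p, d) \<in> Q \<and> p \<noteq> d)"
    if "(a, b) \<in> reach Q S" for b
    using that by (induction rule: reach_induct) (use assms(2) in \<open>auto intro: reach_step\<close>)
  then show ?thesis using that assms(1) by blast
qed

text \<open>For \<open>v \<noteq> z\<close>, \<open>(r, v) \<notin> reach Q {z}\<close> says that
  \<open>z\<close> is a proper ancestor of \<open>v\<close>. By \<open>acyclic\<close> no cycle
  passes through \<open>z\<close>; by \<open>dfs\<close> an edge of \<open>E\<close> between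
  descendants of \<open>z\<close> stays in one branch at \<open>z\<close>.\<close>

locale dfs_relation =
  fixes V :: "'a set" and E Q :: "'a rel" and r :: 'a
  assumes finite_V: "finite V"
    and E_in_V: "E \<subseteq> V \<times> V"
    and symQ: "sym Q"
    and r_V: "r \<in> V"
    and Q_V: "Q \<subseteq> V \<times> V"
    and connected: "v \<in> V \<Longrightarrow> (r, v) \<in> Q\<^sup>*"
    and acyclic: "(z, a) \<in> Q \<Longrightarrow> (z, b) \<in> Q \<Longrightarrow> (a, b) \<in> reach Q {z} \<Longrightarrow> a = b"
    and dfs: "z \<in> V \<Longrightarrow> (u, v) \<in> E \<Longrightarrow> u \<noteq> z \<Longrightarrow> v \<noteq> z \<Longrightarrow> (r, u) \<notin> reach Q {z} \<Longrightarrow>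
      (r, v) \<notin> reach Q {z} \<Longrightarrow> (u, v) \<in> reach Q {z}"
begin

section \<open>Branches and ancestors\<close>

lemma Q_sym: "(u, v) \<in> Q \<Longrightarrow> (v, u) \<in> Q"
  using symQ by (auto dest: symD)

lemmas r_sym = reach_sym[OF symQ]

lemma r_eucl: "(a, b) \<in> reach Q S \<Longrightarrow> (a, c) \<in> reach Q S \<Longrightarrow> (b, c) \<in> reach Q S"
  using reach_trans[OF r_sym] .

lemma r_meet: "(a, c) \<in> reach Q S \<Longrightarrow> (b, c) \<in> reach Q S \<Longrightarrow> (a, b) \<in> reach Q S"
  using reach_trans[OF _ r_sym] .

lemma connected2: "u \<in> V \<Longrightarrow> v \<in> V \<Longrightarrow> (u, v) \<in> reach Q {}"
  by (rule r_eucl[of r]) (simp_all add: connected reach_empty)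

text \<open>By \<open>acyclic\<close>, \<open>t\<close> is the only neighbour of \<open>z\<close> in
  its branch, so a walk from the root can enter the branch only at \<open>t\<close>.\<close>

lemma branch_root:
  assumes z: "(z, t) \<in> Q" "z \<noteq> t" and r: "(r, t) \<notin> reach Q {z}" and w: "(t, w) \<in> reach Q {z}"
  shows "(r, w) \<notin> reach Q {t}"
proof
  assume rw: "(r, w) \<in> reach Q {t}"
  have "closed_off Q {t} {x. (t, x) \<notin> reach Q {z}}"
    unfolding closed_off_def
  proof (intro allI impI, rule ccontr)
    fix x x' assume x: "(x, x') \<in> Q" "x \<in> {x. (t, x) \<notin> reach Q {z}}"
      "x' \<notin> {x. (t, x) \<notin> reach Q {z}} \<union> {t}"
    then have x': "(t, x') \<in> reach Q {z}" "x' \<noteq> t" by auto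
    then have "x' \<noteq> z" using reach_isolated[of t z Q "{z}"] z(2) by auto
    show False
    proof (cases "x = z")
      case True
      then show False using acyclic[OF z(1) _ x'(1)] x(1) x'(2) by auto
    next
      case False
      then show False using reach_step[OF x'(1) Q_sym[OF x(1)]] \<open>x' \<noteq> z\<close> x(2) by auto
    qed
  qed
  then have "w \<in> {x. (t, x) \<notin> reach Q {z}}"
    by (rule reach_closed[OF rw, rotated]) (use r r_sym[of t r] in auto)
  then show False using w by simp
qed

text \<open>Ends of an edge are comparable in the tree order. Take the deepest common ancestor
  \<open>z\<close> of both: if \<open>z\<close> is none of them, then both lie in the same branch at \<open>z\<close>, and the topmost
  vertex of that branch is a deeper common ancestor.\<close>

lemma comparable:
  assumes uv: "(u, v) \<in> E" "u \<noteq> v"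
  shows "(r, v) \<notin> reach Q {u} \<or> (r, u) \<notin> reach Q {v}"
proof (rule ccontr)
  assume "\<not> ?thesis"
  then have n: "(r, v) \<in> reach Q {u}" "(r, u) \<in> reach Q {v}" by auto
  \<comment> \<open>\<open>below z\<close> consists of \<open>z\<close> and its descendants. Its
    size replaces depth: a common ancestor with fewest descendants is deepest.\<close>
  define below where "below z = {w \<in> V. w = z \<or> (r, w) \<notin> reach Q {z}}" for z
  define Z where "Z = {z \<in> V. u \<in> below z \<and> v \<in> below z}"
  have V: "u \<in> V" "v \<in> V" using uv E_in_V by auto
  have "w \<in> below r" if "w \<in> V" for w
    using that reach_isolated[OF r_sym, of r w "{r}"] unfolding below_def by auto
  then have root: "r \<in> Z" using V r_V unfolding Z_def by auto
  define z where "z = arg_min (\<lambda>z. card (below z)) (\<lambda>z. z \<in> Z)"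
  have zZ: "z \<in> Z" and z_min: "\<And>t. t \<in> Z \<Longrightarrow> card (below z) \<le> card (below t)"
    using arg_min_nat_lemma[of "\<lambda>z. z \<in> Z" r "\<lambda>z. card (below z)"] root
    unfolding z_def by blast+
  have zV: "z \<in> V" and zuv: "z \<noteq> u" "z \<noteq> v" "(r, u) \<notin> reach Q {z}" "(r, v) \<notin> reach Q {z}"
    using zZ n uv unfolding Z_def below_def by auto
  then have uvz: "(u, v) \<in> reach Q {z}" using dfs[OF zV uv(1)] by auto
  obtain t where t: "(v, t) \<in> reach Q {z}" "(t, z) \<in> Q" "t \<noteq> z"
    by (rule first_arrival[OF connected2[OF V(2) zV] zuv(2)[symmetric]])
  have rt: "(r, t) \<notin> reach Q {z}" using zuv(4) reach_trans[OF _ r_sym[OF t(1)]] by blast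
  have "(r, w) \<notin> reach Q {t}" if "(t, w) \<in> reach Q {z}" for w
    using branch_root[OF Q_sym[OF t(2)] _ rt that] t(3) by auto
  moreover have "(t, v) \<in> reach Q {z}" "(t, u) \<in> reach Q {z}"
    using r_sym[OF t(1)] reach_trans[OF _ r_sym[OF uvz]] by blast+
  ultimately have "t \<in> Z" using t(2) V Q_V unfolding Z_def below_def by blast
  moreover have "below t \<subset> below z"
  proof
    show "below t \<subseteq> below z"
      using rt reach_avoid[of r _ Q "{z}" "{t}"] t Q_V unfolding below_def by auto
    have "(r, z) \<in> reach Q {t}"
    proof (cases "r = z")
      case False
      then obtain p where p: "(r, p) \<in> reach Q {z}" "(p, z) \<in> Q" "p \<noteq> z"
        by (rule first_arrival[OF connected2[OF r_V zV]])
      then have "(r, p) \<in> reach Q {t}" "p \<noteq> t" using rt reach_avoid[of r p Q "{z}" "{t}"] by auto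
      then show ?thesis using p(2) t(3) by (auto intro: reach_step)
    qed auto
    then show "below t \<noteq> below z" using t(3) zV unfolding below_def by auto
  qed
  moreover have "finite (below z)" using finite_V unfolding below_def by auto
  ultimately show False using z_min psubset_card_mono by (metis leD)
qed

section \<open>Graph edges leaving a closed-off set\<close>

lemma closed_off_nbr:
  assumes C: "closed_off Q {d} C" "d \<notin> C" "r \<notin> C" "d \<in> V"
    and c: "c \<in> C" "(c, u) \<in> E" "u \<notin> C" "u \<noteq> d"
  shows "(r, u) \<in> reach Q {d}"
proof (rule ccontr)
  assume "\<not> ?thesis"
  \<comment> \<open>Now both \<open>c\<close> and \<open>u\<close> are descendants of
    \<open>d\<close>, so \<open>dfs\<close> puts them in one branch at \<open>d\<close>, and this
    branch cannot leave \<open>C\<close>.\<close>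
  moreover have "(r, c) \<notin> reach Q {d}" using reach_closed[OF r_sym c(1) C(1)] C(3) by blast
  ultimately have "(c, u) \<in> reach Q {d}" using dfs[OF C(4) c(2)] c C by blast
  then show False using reach_closed[OF _ c(1) C(1)] c by blast
qed

text \<open>\<open>c\<close> and \<open>u\<close> are comparable, and \<open>c\<close> is not above
  \<open>u\<close> because the root reaches \<open>u\<close> off \<open>d\<close>, hence off
  \<open>c\<close>. So \<open>u\<close> is an ancestor of \<open>c\<close>, and as \<open>c\<close>
  reaches \<open>d\<close> off \<open>u\<close>, also of \<open>d\<close>.\<close>

lemma closed_off_nbr_separates:
  assumes C: "closed_off Q {d} C" "d \<notin> C" "r \<notin> C" "d \<in> V"
    and c: "c \<in> C" "(c, u) \<in> E" "u \<notin> C" "u \<noteq> d"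
  shows "(r, d) \<notin> reach Q {u}"
proof
  assume rd: "(r, d) \<in> reach Q {u}"
  have rc: "(r, c) \<notin> reach Q {d}" using reach_closed[OF r_sym c(1) C(1)] C(3) by blast
  have "(r, u) \<in> reach Q {c}"
    using reach_avoid[OF closed_off_nbr[OF assms]] rc by blast
  then have rcu: "(r, c) \<notin> reach Q {u}" using comparable[OF c(2)] c by blast
  have "c \<in> V" "c \<noteq> d" using c C E_in_V by auto
  then obtain p where p: "(c, p) \<in> reach Q {d}" "(p, d) \<in> Q" "p \<noteq> d"
    using first_arrival[OF connected2[OF \<open>c \<in> V\<close> C(4)]] by blast
  have cu: "(c, u) \<notin> reach Q {d}" using reach_closed[OF _ c(1) C(1)] c by blast
  then have "(c, p) \<in> reach Q {u}" using reach_avoid[OF p(1)] by blast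
  moreover have "p \<noteq> u" using cu p by auto
  ultimately have "(c, d) \<in> reach Q {u}" using p(2) c(4) by (auto intro: reach_step)
  then show False using rcu r_meet[OF rd] by blast
qed

text \<open>By \<open>closed_off_nbr\<close> the root reaches both \<open>a\<close> and
  \<open>u\<close> off \<open>w\<close>, so they lie in one component off \<open>w\<close>, which
  does not leave \<open>A\<close>.\<close>

lemma adjacent_closed_off:
  assumes A: "closed_off Q {w} A"
    and C: "closed_off Q {w} C" "w \<notin> C" "r \<notin> C" "w \<in> V"
    and AC: "A \<inter> C = {}" "a \<in> A" "w \<notin> A" "c \<in> C" "(c, a) \<in> E"
    and c': "c' \<in> C" "(c', u) \<in> E" "u \<notin> C" "u \<noteq> w"
  shows "u \<in> A"
proof -
  have "(r, a) \<in> reach Q {w}" using closed_off_nbr[OF C AC(4,5)] AC by blast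
  moreover have "(r, u) \<in> reach Q {w}" using closed_off_nbr[OF C c'] .
  ultimately have "(a, u) \<in> reach Q {w}" by (rule r_eucl)
  then show ?thesis using reach_closed[OF _ AC(2) A] by blast
qed

text \<open>Both \<open>u\<close> and \<open>w\<close> are ancestors of \<open>d\<close>. If the
  tree path from the root to \<open>d\<close> avoided \<open>d'\<close>, it would join
  \<open>u\<close> to \<open>w\<close> off \<open>d\<close> and \<open>d'\<close>, although
  \<open>X\<close> contains only one of them.\<close>

lemma two_exits_separate:
  assumes X: "closed_off Q {d, d'} X" "u \<in> X" "w \<notin> X"
    and C: "closed_off Q {d} C" "d \<notin> C" "r \<notin> C" "d \<in> V"
    and c: "c \<in> C" "(c, u) \<in> E" "u \<notin> C" "u \<noteq> d"
    and c': "c' \<in> C" "(c', w) \<in> E" "w \<notin> C" "w \<noteq> d"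
  shows "(r, d) \<notin> reach Q {d'}"
proof
  assume rd: "(r, d) \<in> reach Q {d'}"
  have "r \<noteq> d" using closed_off_nbr[OF C c'] c'(4) reach_isolated[OF r_sym] by blast
  then obtain p where p: "(r, p) \<in> reach Q {d, d'}" "(p, d) \<in> Q" "p \<noteq> d"
    by (rule first_arrival[OF rd])
  have "(r, s) \<in> reach Q {d, d'}" if s: "(r, d) \<notin> reach Q {s}" "s \<noteq> d" for s
  proof (rule ccontr)
    assume n: "\<not> ?thesis"
    then have "(r, p) \<in> reach Q {s}" "p \<noteq> s" using reach_avoid[OF p(1)] p(1) by auto
    then show False using s p(2) by (auto intro: reach_step)
  qed
  then have "(r, u) \<in> reach Q {d, d'}" "(r, w) \<in> reach Q {d, d'}"
    using closed_off_nbr_separates[OF C c] closed_off_nbr_separates[OF C c'] c c' by blast+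
  then have "(u, w) \<in> reach Q {d, d'}" by (rule r_eucl)
  then show False using reach_closed[OF _ X(2,1)] X(3) by blast
qed

text \<open>From a root in \<open>C'\<close>, \<open>d'\<close> is reached off every other vertex
  outside \<open>C'\<close>. The ancestors \<open>u\<close> and \<open>w\<close> of \<open>d\<close>
  would thus separate \<open>d'\<close> from \<open>d\<close>; both would lie on the tree path
  between these, against the choice of \<open>X\<close>.\<close>

lemma two_exits_root:
  assumes X: "closed_off Q {d, d'} X" "u \<in> X" "w \<notin> X"
    and C: "closed_off Q {d} C" "d \<notin> C" "r \<notin> C" "d \<in> V"
    and c: "c \<in> C" "(c, u) \<in> E" "u \<notin> C" "u \<noteq> d"
    and c': "c' \<in> C" "(c', w) \<in> E" "w \<notin> C" "w \<noteq> d"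
    and C': "closed_off Q {d'} C'" "d' \<notin> C'" "d' \<in> V" "d \<noteq> d'"
    and uw: "u \<noteq> d'" "w \<noteq> d'" "u \<notin> C'" "w \<notin> C'"
  shows "r \<notin> C'"
proof
  assume r: "r \<in> C'"
  then have "r \<noteq> d'" using C' by auto
  then obtain p where p: "(r, p) \<in> reach Q {d'}" "(p, d') \<in> Q" "p \<noteq> d'"
    by (rule first_arrival[OF connected2[OF r_V C'(3)]])
  have rd': "(r, d') \<in> reach Q {s}" if s: "s \<notin> C'" "s \<noteq> d'" for s
  proof -
    have "(r, s) \<notin> reach Q {d'}" using reach_closed[OF _ r C'(1)] s by blast
    then have "(r, p) \<in> reach Q {s}" "p \<noteq> s" using reach_avoid[OF p(1)] p(1) by auto
    then show ?thesis using s p(2) by (auto intro: reach_step)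
  qed
  \<comment> \<open>\<open>q\<close> is the neighbour of \<open>d'\<close> on the tree path from
    \<open>d\<close>; both \<open>u\<close> and \<open>w\<close> will be reached from it.\<close>
  obtain q where q: "(d, q) \<in> reach Q {d'}" "(q, d') \<in> Q" "q \<noteq> d'"
    by (rule first_arrival[OF connected2[OF C(4) C'(3)] C'(4)])
  have qs: "q \<noteq> d \<and> (q, s) \<in> reach Q {d, d'}"
    if s: "s \<notin> C'" "s \<noteq> d'" "s \<noteq> d" "(r, d) \<notin> reach Q {s}" for s
  proof -
    have n: "(d', d) \<notin> reach Q {s}" using reach_trans[OF rd'[OF s(1,2)]] s(4) by blast
    have qd: "q \<noteq> d"
    proof
      assume "q = d"
      then show False using n reach_edge[OF Q_sym[OF q(2)], of "{s}"] s(2,3) by auto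
    qed
    then obtain p where p: "(q, p) \<in> reach Q {d, d'}" "(p, d) \<in> Q" "p \<noteq> d"
      by (rule first_arrival[OF r_sym[OF q(1)]])
    have "(q, s) \<in> reach Q {d, d'}"
    proof (rule ccontr)
      assume "\<not> ?thesis"
      then have "(q, p) \<in> reach Q {s}" "p \<noteq> s" "q \<noteq> s" using reach_avoid[OF p(1)] p(1) by auto
      then have "(d', d) \<in> reach Q {s}"
        using reach_step[OF reach_trans[OF reach_edge[OF Q_sym[OF q(2)]]] p(2), of "{s}"] s(2,3)
        by simp
      then show False using n by simp
    qed
    then show ?thesis using qd by simp
  qed
  have "(q, u) \<in> reach Q {d, d'}" "(q, w) \<in> reach Q {d, d'}"
    using qs[OF uw(3,1) c(4) closed_off_nbr_separates[OF C c]]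
      qs[OF uw(4,2) c'(4) closed_off_nbr_separates[OF C c']] by blast+
  then have "(u, w) \<in> reach Q {d, d'}" by (rule r_eucl)
  then show False using reach_closed[OF _ X(2,1)] X(3) by blast
qed

lemma separates_antisym:
  assumes "(r, d) \<notin> reach Q {d'}" "d \<in> V" "d \<noteq> d'"
  shows "(r, d') \<in> reach Q {d}"
proof (rule ccontr)
  assume n: "\<not> ?thesis"
  then have "r \<noteq> d'" by auto
  have rd: "r \<noteq> d" using assms by auto
  then obtain p where p: "(r, p) \<in> reach Q {d}" "(p, d) \<in> Q" "p \<noteq> d"
    by (rule first_arrival[OF connected2[OF r_V assms(2)]])
  then have "(r, p) \<in> reach Q {d'}" "p \<noteq> d'" using n reach_avoid[OF p(1)] by auto
  then show False using assms p(2) by (auto intro: reach_step)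
qed

end

section \<open>Minimal fragments along a depth-first tree\<close>

text \<open>Counts for \<open>B\<close> crossed with a fragment \<open>D\<close>, where k = 2m + 1:
  \<open>b\<close>, \<open>t\<close>, \<open>e\<close> are the rows \<open>B\<close>,
  \<open>N B\<close>, \<open>co B\<close>, and the indices are the columns \<open>D\<close>,
  \<open>N D\<close>, \<open>co D\<close>. The strict bounds will come from minimality of
  \<open>B\<close>, and \<open>b2\<close> from a clique of size m inside
  \<open>B \<inter> N D\<close>. The last two outcomes are mirror images.\<close>

lemma descent_arith:
  fixes b1 b2 b3 t1 t2 t3 e1 e2 e3 m :: nat
  assumes sums: "t1 + t2 + t3 = 2 * m + 1" "b2 + t2 + e2 = 2 * m + 1"
    and sizes: "m \<le> e1 + e2 + e3" "m \<le> b1 + t1 + e1" "m \<le> b3 + t3 + e3"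
    and e: "e1 = 0 \<or> 2 * m + 1 \<le> e2 + t2 + t1" "e3 = 0 \<or> 2 * m + 1 \<le> e2 + t2 + t3"
    and b: "b1 = 0 \<or> 2 * m + 1 < b2 + t2 + t1" "b3 = 0 \<or> 2 * m + 1 < b2 + t2 + t3"
    and b2: "m \<le> b2"
  obtains "b1 = 0" "b3 = 0" "b2 \<le> m + 1"
  | "b1 > 0" "b3 = 0" "e3 = 0" "t2 = 0" "t1 = m + 1" "t3 = m" "b2 = m + 1" "e2 = m"
  | "b3 > 0" "b1 = 0" "e1 = 0" "t2 = 0" "t3 = m + 1" "t1 = m" "b2 = m + 1" "e2 = m"
proof (cases "b1 = 0")
  case b1: True
  show thesis
  proof (cases "b3 = 0")
    case b3: True
    have "b2 \<le> m + 1"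
    proof (cases "e1 = 0 \<and> e3 = 0")
      case True
      then show ?thesis using sums sizes by linarith
    next
      case False
      moreover have "m \<le> t1" if "e3 \<noteq> 0" using that e sums sizes b1 b2 by linarith
      moreover have "m \<le> t3" if "e1 \<noteq> 0" using that e sums sizes b3 b2 by linarith
      ultimately show ?thesis using e sums sizes b1 b3 by linarith
    qed
    then show thesis using that(1) b1 b3 by blast
  next
    case b3: False
    then have 1: "2 * m + 1 < b2 + t2 + t3" using b by blast
    then have e1: "e1 = 0" using e sums by linarith
    then have t1: "m \<le> t1" using sizes b1 by linarith
    have "t3 \<ge> m + 1"
      using e(2) 1 sums sizes e1 t1 by (cases "e3 = 0") (simp; linarith)+
    then have "t3 = m + 1" "t1 = m" "t2 = 0" using t1 sums by linarith+
    moreover have "b2 \<ge> m + 1" using 1 calculation by linarith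
    moreover have "e2 \<ge> m" using e(2) sizes e1 calculation sums by (cases "e3 = 0") (simp; linarith)+
    moreover have "b2 = m + 1" "e2 = m" using calculation sums by linarith+
    ultimately show thesis using that(3) b1 b3 e1 by blast
  qed
next
  case b1: False
  then have 1: "2 * m + 1 < b2 + t2 + t1" using b by blast
  then have e3: "e3 = 0" using e sums by linarith
  have b3: "b3 = 0"
  proof (rule ccontr)
    assume "b3 \<noteq> 0"
    then have 3: "2 * m + 1 < b2 + t2 + t3" using b by blast
    then have "e1 = 0" using e sums by linarith
    then have "m \<le> e2" using e3 sizes by simp
    then show False using 1 3 sums by linarith
  qed
  then have t3: "m \<le> t3" using sizes e3 by linarith
  have "t1 \<ge> m + 1"
    using e(1) 1 sums sizes e3 t3 by (cases "e1 = 0") (simp; linarith)+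
  then have "t1 = m + 1" "t3 = m" "t2 = 0" using t3 sums by linarith+
  moreover have "b2 \<ge> m + 1" using 1 calculation by linarith
  moreover have "e2 \<ge> m" using e(1) sizes e3 calculation sums by (cases "e1 = 0") (simp; linarith)+
  moreover have "b2 = m + 1" "e2 = m" using calculation sums by linarith+
  ultimately show thesis using that(2) b1 b3 e3 by blast
qed

text \<open>\<open>K\<close> stands for the contractible edges, and \<open>unique\<close> is the
  negation of the claim: at most one tree edge is contractible. The aim is to show this locale
  inconsistent.\<close>

locale dense_dfs = dense_kconn V E k + dfs_relation V E Q r
  for V :: "'a set" and E Q :: "'a rel" and k :: nat and r :: 'a +
  fixes K :: "'a set set"
  assumes QE: "Q \<subseteq> E"
    and noncontractible: "(x, y) \<in> Q \<Longrightarrow> {x, y} \<notin> K \<Longrightarrow> \<exists>F. fragment F \<and> x \<in> N F \<and> y \<in> N F"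
    and unique: "(x, y) \<in> Q \<Longrightarrow> {x, y} \<in> K \<Longrightarrow> (x', y') \<in> Q \<Longrightarrow> {x', y'} \<in> K \<Longrightarrow>
      {x, y} = {x', y'}"
begin

definition qfragment :: "'a set \<Rightarrow> bool" where
  "qfragment F \<longleftrightarrow> fragment F \<and> (\<exists>x y. (x, y) \<in> Q \<and> x \<in> N F \<and> y \<in> N F)"

definition qend :: "'a set \<Rightarrow> bool" where
  "qend F \<longleftrightarrow> qfragment F \<and> (\<forall>F'. F' \<subset> F \<longrightarrow> \<not> qfragment F')"

definition leaving :: "'a set \<Rightarrow> 'a \<Rightarrow> 'a \<Rightarrow> bool" where
  "leaving A x y \<longleftrightarrow> (x, y) \<in> Q \<and> x \<in> A \<and> y \<notin> A"

definition good :: "'a set \<Rightarrow> bool" where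
  "good A \<longleftrightarrow> (\<exists>x y. leaving A x y \<and> {x, y} \<in> K)"

definition bad :: "'a set \<Rightarrow> bool" where
  "bad A \<longleftrightarrow> qend A \<and> \<not> good A"

section \<open>Tree edges leaving minimal fragments\<close>

lemma Q_E: "(x, y) \<in> Q \<Longrightarrow> (x, y) \<in> E"
  using QE by auto

lemma qend_fragment: "qend A \<Longrightarrow> fragment A"
  by (simp add: qend_def qfragment_def)

lemma qfragmentI: "fragment F \<Longrightarrow> (x, y) \<in> Q \<Longrightarrow> x \<in> N F \<Longrightarrow> y \<in> N F \<Longrightarrow> qfragment F"
  by (auto simp: qfragment_def)

lemma ex_qend:
  assumes "qfragment F" obtains A where "A \<subseteq> F" "qend A"
proof -
  have "finite F" using fin[OF fragmentD(1)] assms by (simp add: qfragment_def)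
  then have "qfragment F \<longrightarrow> (\<exists>A \<subseteq> F. qend A)"
  proof (induction F rule: finite_psubset_induct)
    case (psubset F)
    show ?case
    proof (cases "qend F")
      case False
      show ?thesis
      proof
        assume "qfragment F"
        then obtain F' where F': "F' \<subset> F" "qfragment F'" using False by (auto simp: qend_def)
        then obtain A where "A \<subseteq> F'" "qend A" using psubset.IH by meson
        then show "\<exists>A \<subseteq> F. qend A" using F'(1) by blast
      qed
    qed blast
  qed
  then show thesis using assms that by blast
qed

text \<open>A full fragment has the least size of any fragment, so no proper subset of it is
  one.\<close>

lemma full_qend:
  assumes "full F" "qfragment F" shows "qend F"
proof -
  have "\<not> qfragment F'" if "F' \<subset> F" for F'
  proof
    assume "qfragment F'"
    then have "k \<le> 2 * card F' + 1" using card_fragment by (auto simp: qfragment_def)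
    moreover have "card F' < card F"
      using that fin[OF fragmentD(1)[OF fullD(1)[OF assms(1)]]] by (rule psubset_card_mono[rotated])
    ultimately show False using fullD(2)[OF assms(1)] by linarith
  qed
  then show ?thesis using assms by (auto simp: qend_def)
qed

lemma leaving_N: "leaving A x y \<Longrightarrow> y \<in> N A"
  by (auto simp: leaving_def intro: N_I Q_E)

lemma ex_leaving:
  assumes "fragment A" obtains x y where "leaving A x y"
proof -
  obtain a b where ab: "a \<in> A" "b \<in> co A" using fragmentD[OF assms] by blast
  then have "(a, b) \<in> reach Q {}"
    using connected2 fragmentD(1)[OF assms] co_subset by blast
  moreover have "b \<notin> A" using ab by (auto simp: co_def)
  ultimately have "\<not> closed_off Q {} A" using reach_closed[OF _ ab(1)] by blast
  then show thesis using that by (auto simp: closed_off_def leaving_def)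
qed

lemma qend_crossing:
  assumes A: "qend A" and xy: "leaving A x y" and B: "fragment B" "x \<in> N B" "y \<in> N B"
  shows "full A" "A \<subseteq> N B" "N A \<inter> N B = {y}"
    "2 * card (N A \<inter> B) + 1 = k" "2 * card (N A \<inter> co B) + 1 = k"
proof -
  have x: "x \<in> A" "(x, y) \<in> Q" using xy by (auto simp: leaving_def)
  have min: "False" if "fragment F" "F \<subset> A" "x \<in> N F" "y \<in> N F" for F
    using A qfragmentI[OF that(1) x(2) that(3,4)] that(2) by (auto simp: qend_def)
  note * = crossing_end[OF qend_fragment[OF A] B(1) x(1) B(2) leaving_N[OF xy] B(3) min]
  show "full A" "A \<subseteq> N B" "N A \<inter> N B = {y}"
    "2 * card (N A \<inter> B) + 1 = k" "2 * card (N A \<inter> co B) + 1 = k"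
    by (rule *; assumption)+
qed

lemma badD:
  assumes "bad A"
  shows "qend A" "leaving A x y \<Longrightarrow> {x, y} \<notin> K"
  using assms by (auto simp: bad_def good_def)

lemma bad_leaving:
  assumes "bad A" "leaving A x y"
  obtains B where "fragment B" "x \<in> N B" "y \<in> N B"
  using noncontractible badD[OF assms(1)] assms(2) unfolding leaving_def by meson

text \<open>Some tree edge leaves \<open>A\<close>; it is not contractible, so
  \<open>qend_crossing\<close> applies to a separator through it.\<close>

lemma bad_full:
  assumes "bad A" shows "full A"
proof -
  obtain x y where xy: "leaving A x y" using ex_leaving qend_fragment badD(1) assms by metis
  obtain B where "fragment B" "x \<in> N B" "y \<in> N B" using bad_leaving[OF assms xy] by metis
  then show ?thesis using qend_crossing(1)[OF badD(1)[OF assms] xy] by blast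
qed

section \<open>Adjacent full fragments\<close>

lemma not_singleton_full: "full A \<Longrightarrow> \<not> A \<subseteq> {y}"
  using fullD(3)[of A] card_mono[of "{y}" A] by auto

text \<open>Otherwise a separator \<open>N B\<close> contains \<open>x\<close> and \<open>y\<close>.
  Crossing it with \<open>C\<close> gives \<open>C \<subseteq> N B\<close>, and with
  \<open>A\<close> gives \<open>N A \<inter> N B = {y}\<close>; as \<open>C \<subseteq> N A\<close>,
  \<open>C\<close> would have only one vertex.\<close>

lemma contractible_between:
  assumes A: "qend A" "full A" and C: "qend C" "full C" and adj: "A \<inter> N C \<noteq> {}"
    and xy: "(x, y) \<in> Q" "x \<in> A" "y \<in> C"
  shows "{x, y} \<in> K"
proof (rule ccontr)
  assume "{x, y} \<notin> K"
  then obtain B where B: "fragment B" "x \<in> N B" "y \<in> N B" using noncontractible[OF xy(1)] by blast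
  note s = full_adjacent[OF A(2) C(2) adj]
  have l: "leaving A x y" "leaving C y x"
    using xy s N_disjoint[of A] N_disjoint[of C] Q_sym by (auto simp: leaving_def)
  have "C \<subseteq> N A \<inter> N B" using s(2) qend_crossing(2)[OF C(1) l(2) B(1,3,2)] by blast
  then have "C \<subseteq> {y}" unfolding qend_crossing(3)[OF A(1) l(1) B] .
  then show False using not_singleton_full C by blast
qed

text \<open>The clique \<open>X\<close> lies on one side \<open>D\<close> of a separator through
  \<open>c\<close> and \<open>d\<close>, and by its size it is all of \<open>N C \<inter> D\<close>.
  If \<open>w\<close> differed from \<open>d\<close>, it would lie on the other side, yet it has a
  neighbour in \<open>X\<close>.\<close>

lemma exit_unique:
  assumes C: "qend C" "full C" and X: "qend X" "full X" and adj: "C \<inter> N X \<noteq> {}"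
    and cd: "leaving C c d" "{c, d} \<notin> K" and w: "w \<in> N C" "w \<in> N X"
  shows "d = w"
proof (rule ccontr)
  assume dw: "d \<noteq> w"
  note s = full_adjacent[OF C(2) X(2) adj]
  have cdQ: "(c, d) \<in> Q" "c \<in> C" using cd by (auto simp: leaving_def)
  have dX: "d \<notin> X" using contractible_between[OF C X adj cdQ] cd(2) by blast
  obtain D0 where D0: "fragment D0" "c \<in> N D0" "d \<in> N D0" using noncontractible[OF cdQ(1) cd(2)] by blast
  have "N C \<inter> N D0 \<subseteq> {d}" using qend_crossing(3)[OF C(1) cd(1) D0] by simp
  then have "X \<inter> N D0 = {}" using s dX by blast
  then have "X \<subseteq> D0 \<or> X \<subseteq> co D0" using full_side[OF X(2) D0(1)] by blast
  then obtain D where D: "fragment D" "c \<in> N D" "d \<in> N D" "X \<subseteq> D"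
    using D0 fragment_co N_co by metis
  note cr = qend_crossing[OF C(1) cd(1) D(1-3)]
  have "N C \<inter> D = X"
  proof -
    have "finite (N C \<inter> D)" using fin[OF N_subset] by auto
    moreover have "card X = card (N C \<inter> D)" using cr(4) fullD(2)[OF X(2)] by linarith
    ultimately show ?thesis using card_subset_eq s D(4) by (metis Int_greatest)
  qed
  moreover have "w \<notin> X" using w N_disjoint by blast
  moreover have "w \<notin> N D" using w(1) equalityD1[OF cr(3)] dw by blast
  ultimately have "w \<in> co D" using w(1) N_subset[of C] by (auto simp: co_def)
  moreover obtain u where "u \<in> X" "(u, w) \<in> E" using w N_E by metis
  ultimately show False using no_edge_co D(4) by blast
qed

lemma closed_off_exit:
  assumes C: "bad C" and X: "qend X" "full X" and adj: "C \<inter> N X \<noteq> {}" and w: "w \<in> N C" "w \<in> N X"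
  shows "closed_off Q {w} C"
proof -
  have "d = w" if "leaving C c d" for c d
    using exit_unique[OF badD(1)[OF C] bad_full[OF C] X adj that badD(2)[OF C that] w] .
  then show ?thesis unfolding closed_off_def leaving_def by blast
qed

text \<open>\<open>w\<close> is the only exit of the tree from either clique. The depth-first
  property then puts \<open>N C\<close> inside \<open>insert w A\<close>, too small since
  \<open>k = 2 * card A + 1\<close>.\<close>

lemma adjacent_bad_aux:
  assumes A: "bad A" and C: "bad C" and adj: "C \<inter> N A \<noteq> {}" and w: "w \<in> N A" "w \<in> N C"
    and r: "r \<notin> C"
  shows False
proof -
  note fA = bad_full[OF A] and fC = bad_full[OF C]
  note s = full_adjacent[OF fC fA adj]
  have adj': "A \<inter> N C \<noteq> {}" using s fragmentD(2)[OF fullD(1)[OF fA]] by blast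
  have clC: "closed_off Q {w} C" using closed_off_exit[OF C badD(1)[OF A] fA adj w(2,1)] .
  have clA: "closed_off Q {w} A" using closed_off_exit[OF A badD(1)[OF C] fC adj' w] .
  have wn: "w \<notin> C" "w \<notin> A" "w \<in> V" using w N_disjoint N_subset by blast+
  have AC: "A \<inter> C = {}" using s N_disjoint by blast
  obtain a where a: "a \<in> A" using fragmentD(2)[OF fullD(1)[OF fA]] by blast
  obtain c where c: "c \<in> C" "(c, a) \<in> E" using s(2) a N_E by blast
  have "N C \<subseteq> insert w A"
  proof
    fix u assume "u \<in> N C"
    then obtain c' where c': "c' \<in> C" "(c', u) \<in> E" "u \<notin> C" by (rule N_E)
    then show "u \<in> insert w A"
      using adjacent_closed_off[OF clA clC wn(1) r wn(3) AC a wn(2) c c'] by blast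
  qed
  moreover have "finite A" using fin fragmentD(1) fullD(1) fA by blast
  ultimately have "k \<le> card A + 1"
    using card_mono[of "insert w A" "N C"] fragmentD(3)[OF fullD(1)[OF fC]] wn by simp
  then show False using fullD(2,3)[OF fA] by linarith
qed

lemma adjacent_bad:
  assumes A: "bad A" and C: "bad C" and adj: "C \<inter> N A \<noteq> {}" and w: "w \<in> N A" "w \<in> N C"
  shows False
proof -
  note fA = bad_full[OF A] and fC = bad_full[OF C]
  note s = full_adjacent[OF fC fA adj]
  have adj': "A \<inter> N C \<noteq> {}" using s fragmentD(2)[OF fullD(1)[OF fA]] by blast
  have "r \<notin> C \<or> r \<notin> A" using s N_disjoint by blast
  then show False
    using adjacent_bad_aux[OF A C adj w] adjacent_bad_aux[OF C A adj' w(2,1)] by blast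
qed

text \<open>The only contractible tree edge would leave both \<open>F\<close> and \<open>F'\<close>
  and thus join \<open>B\<close> to \<open>co B\<close>.\<close>

lemma good_both_sides:
  assumes B: "fragment B" and F: "F \<subseteq> B" "good F" and F': "F' \<subseteq> co B" "good F'"
  shows False
proof -
  obtain x y where xy: "leaving F x y" "{x, y} \<in> K" using F by (auto simp: good_def)
  obtain x' y' where xy': "leaving F' x' y'" "{x', y'} \<in> K" using F' by (auto simp: good_def)
  have "{x, y} = {x', y'}" using unique xy xy' by (auto simp: leaving_def)
  moreover have "x \<in> B" "x' \<in> co B" "(x, y) \<in> E" using xy xy' F F' Q_E by (auto simp: leaving_def)
  ultimately show False using no_edge_co[of x B x'] by (auto simp: doubleton_eq_iff co_def)
qed

text \<open>The descent runs on \<open>B\<close>. The last condition passes to every subset of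
  \<open>B\<close>, so that \<open>B\<close> can be replaced by one of its corners.\<close>

definition triple :: "'a set \<Rightarrow> 'a \<Rightarrow> 'a \<Rightarrow> 'a set \<Rightarrow> bool" where
  "triple A x y B \<longleftrightarrow> bad A \<and> leaving A x y \<and> fragment B \<and> x \<in> N B \<and> y \<in> N B \<and>
     (\<forall>F. F \<subseteq> B \<longrightarrow> qend F \<longrightarrow> bad F)"

text \<open>\<open>B\<close> contains a bad \<open>C\<close>; cross \<open>B\<close> with a
  separator through a tree edge leaving \<open>C\<close>. By minimality no corner of
  \<open>B\<close> yields a smaller triple, so \<open>descent_arith\<close> leaves two situations:
  \<open>B\<close> lies inside the new separator, which the degree bound refutes, or one side of the
  new separator lies inside \<open>N B\<close> and is the clique \<open>M\<close>.\<close>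

lemma descent:
  assumes T: "triple A x y B"
    and min: "\<forall>A' x' y' B'. triple A' x' y' B' \<longrightarrow> \<not> B' \<subset> B"
  obtains C c d M where "bad C" "C \<subseteq> B" "leaving C c d" "d \<in> B"
    "qend M" "full M" "good M" "N B = insert y A \<union> M" "insert y A \<subseteq> co M"
    "B \<inter> N M = insert d C" "2 * card (co B \<inter> N M) + 1 = k" "N B \<inter> N M = {}" "A \<inter> N C = {}"
proof -
  have A: "bad A" "leaving A x y" and B: "fragment B" "x \<in> N B" "y \<in> N B"
    and Bbad: "\<And>F. F \<subseteq> B \<Longrightarrow> qend F \<Longrightarrow> bad F"
    using T by (auto simp: triple_def)
  note fA = bad_full[OF A(1)]
  note crA = qend_crossing[OF badD(1)[OF A(1)] A(2) B]
  note result = that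
  define m where "m = card A"
  have m: "k = 2 * m + 1" "m \<ge> 2" using fullD[OF fA] by (auto simp: m_def)
  have "qfragment B" using qfragmentI[OF B(1) _ B(2,3)] A(2) by (auto simp: leaving_def)
  then obtain C where CB: "C \<subseteq> B" "qend C" using ex_qend by metis
  then have C: "bad C" using Bbad by blast
  note fC = bad_full[OF C]
  have cC: "card C = m" using fullD(2)[OF fC] m by linarith
  obtain c d where cd: "leaving C c d" using ex_leaving[OF fullD(1)[OF fC]] by metis
  have cdQ: "(c, d) \<in> Q" "c \<in> C" "d \<notin> C" using cd by (auto simp: leaving_def)
  have dN: "d \<in> N C" using leaving_N[OF cd] .
  have dB: "d \<in> B \<union> N B" using dN CB(1) by (auto simp: nbhd_def)
  obtain D0 where D0: "fragment D0" "c \<in> N D0" "d \<in> N D0" using bad_leaving[OF C cd] by metis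
  have finB: "finite B" using fin fragmentD(1)[OF B(1)] .
  have corner: "card (B \<inter> D) = 0 \<or> k < card (B \<inter> N D) + card (N B \<inter> N D) + card (N B \<inter> D)"
    if D: "fragment D" "c \<in> N D" "d \<in> N D" for D
  proof (rule ccontr)
    assume neg: "\<not> ?thesis"
    then have ne: "B \<inter> D \<noteq> {}" by force
    from neg have "card (B \<inter> N D) + card (N B \<inter> N D) + card (N B \<inter> D) \<le> k" by linarith
    note f = corner_fragment[OF B(1) ne this]
    have "c \<in> N (B \<inter> D)" "d \<in> N (B \<inter> D)" unfolding f(2) using D cdQ(2) CB(1) dB by blast+
    then have "triple C c d (B \<inter> D)" using C cd f(1) Bbad by (auto simp: triple_def)
    moreover have "c \<notin> D" using D(2) N_disjoint by blast
    then have "B \<inter> D \<subset> B" using cdQ(2) CB(1) by blast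
    ultimately show False using min by blast
  qed
  \<comment> \<open>The second situation, for a variable \<open>D\<close> so that it also covers the
    mirror image with \<open>co D0\<close>.\<close>
  have beta: thesis
    if D: "fragment D" "c \<in> N D" "d \<in> N D"
      and ne: "card (B \<inter> D) > 0" and z: "card (B \<inter> co D) = 0" "card (co B \<inter> co D) = 0" "card (N B \<inter> N D) = 0"
      and q: "card (N B \<inter> D) = m + 1" "card (N B \<inter> co D) = m" "card (B \<inter> N D) = m + 1"
        "card (co B \<inter> N D) = m" for D
  proof -
    note crC = qend_crossing[OF badD(1)[OF C] cd D]
    define M where "M = co D"
    have NM: "N M = N D" unfolding M_def by (rule N_co[OF D(1)])
    have z': "B \<inter> M = {}" "co B \<inter> M = {}" "N B \<inter> N D = {}"
      using z fin fragmentD(1)[OF B(1)] co_subset N_subset unfolding M_def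
      by (metis card_0_eq finite_Int)+
    have MB: "M \<subseteq> N B" using z' co_subset[of D] unfolding M_def by (auto simp: co_def)
    then have "card M = m" using q(2) unfolding M_def by (simp add: Int_absorb1)
    then have fM: "full M" using fragment_co[OF D(1)] m unfolding full_def M_def by simp
    have qM: "qend M"
      using full_qend[OF fM] qfragmentI[OF fullD(1)[OF fM] cdQ(1)] D NM by blast
    have dinB: "d \<in> B" using dB D(3) z'(3) by blast
    have BN: "B \<inter> N M = insert d C"
    proof -
      have "insert d C \<subseteq> B \<inter> N D" using dinB D(3) CB(1) crC(2) by blast
      moreover have "card (insert d C) = m + 1" using cC cdQ(3) fin[OF fragmentD(1)[OF fullD(1)[OF fC]]] by simp
      ultimately show ?thesis unfolding NM using q(3) card_subset_eq finB by (metis finite_Int)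
    qed
    \<comment> \<open>\<open>N A\<close> meets \<open>B\<close> in \<open>m\<close> vertices,
      \<open>N M\<close> in \<open>m + 1\<close>, so \<open>A\<close> and \<open>M\<close> are
      different full fragments.\<close>
    have AM: "A \<inter> M = {}"
    proof (rule ccontr)
      assume "A \<inter> M \<noteq> {}"
      then have "A = M" using full_eq[OF fA fM] by blast
      then have "2 * (m + 1) + 1 = k" using crA(4) NM q(3) by (simp add: Int_commute)
      then show False using m by simp
    qed
    have ANM: "A \<inter> N M = {}" using crA(2) z'(3) NM by blast
    have yN: "y \<in> N A" using leaving_N[OF A(2)] .
    have yM: "y \<notin> M" "y \<notin> N M" using full_nonadjacent_sym[OF fA fM ANM] yN B(3) z'(3) NM by blast+
    have yA: "y \<notin> A" using yN N_disjoint by blast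
    have fin': "finite A" "finite M" using fin fragmentD(1) fullD(1) fA fM by blast+
    have NB: "N B = insert y A \<union> M"
    proof -
      have "insert y A \<union> M \<subseteq> N B" using crA(2) B(3) MB by blast
      moreover have "card (insert y A \<union> M) = k"
        using AM yM(1) yA fin' m \<open>card M = m\<close> by (simp add: card_Un_disjoint m_def)
      ultimately show ?thesis
        using fragmentD(3)[OF B(1)] card_subset_eq[OF fin[OF N_subset]] by metis
    qed
    have coM: "insert y A \<subseteq> co M"
      using yM AM ANM yN N_subset fragmentD(1)[OF fullD(1)[OF fA]] by (auto simp: co_def)
    \<comment> \<open>If \<open>A\<close> and \<open>C\<close> were adjacent, \<open>C\<close> would
      be all of \<open>N A \<inter> B\<close>. Then no vertex of \<open>A\<close> has a neighbour in
      \<open>B \<inter> D\<close>, which leaves at most \<open>m + 2 < k\<close> vertices for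
      \<open>N (B \<inter> D)\<close>.\<close>
    have AC: "A \<inter> N C = {}"
    proof (rule ccontr)
      assume "A \<inter> N C \<noteq> {}"
      note s = full_adjacent[OF fA fC this]
      have "C \<subseteq> N A \<inter> B" using s CB(1) by blast
      moreover have "card C = card (N A \<inter> B)" using crA(4) cC m by linarith
      ultimately have NAB: "N A \<inter> B = C" using card_subset_eq finB by (metis finite_Int)
      have "N (B \<inter> D) \<subseteq> insert y (insert d C)"
      proof
        fix v assume v: "v \<in> N (B \<inter> D)"
        have "v \<in> (B \<inter> N D) \<union> (N B \<inter> N D) \<union> (N B \<inter> D)" using v N_corner by blast
        then have "v \<in> insert d C \<union> insert y A" using BN NM z'(3) NB unfolding M_def by (auto simp: co_def)
        moreover have "v \<notin> A"
        proof
          assume "v \<in> A"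
          obtain u where u: "u \<in> B" "u \<in> D" "(u, v) \<in> E" using v by (auto elim: N_E)
          have "u \<notin> A" using crA(2) u(1) N_disjoint[of B] by blast
          then have "u \<in> N A" using N_I[OF E_sym[OF u(3)] \<open>v \<in> A\<close>] by blast
          then show False using NAB u crC(2) N_disjoint[of D] by blast
        qed
        ultimately show "v \<in> insert y (insert d C)" by blast
      qed
      moreover have "finite C" using finB CB(1) finite_subset by blast
      ultimately have "card (N (B \<inter> D)) \<le> m + 2"
        using card_mono[of "insert y (insert d C)" "N (B \<inter> D)"] cC
        by (simp add: card_insert_if split: if_splits)
      moreover have "B \<inter> D \<noteq> {}" using ne by force
      then have "k \<le> card (N (B \<inter> D))"
        using separator[of "B \<inter> D"] corner_ne[OF B(1)] fragmentD(1)[OF B(1)] by blast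
      ultimately show False using m by linarith
    qed
    have "good M"
    proof (rule ccontr)
      assume "\<not> good M"
      then have "bad M" using qM by (simp add: bad_def)
      moreover have "C \<inter> N M \<noteq> {}" using crC(2) cdQ(2) NM by blast
      ultimately show False using adjacent_bad[OF _ C] dN D(3) NM by blast
    qed
    moreover have "2 * card (co B \<inter> N M) + 1 = k" using q(4) m NM by simp
    ultimately show thesis
      using result[OF C CB(1) cd dinB qM fM _ NB coM BN _ _ AC] z'(3) NM by blast
  qed
  note cells = crossing_cells[OF B(1) D0(1)]
  have CD: "C \<subseteq> N D0" using qend_crossing(2)[OF badD(1)[OF C] cd D0] .
  have b2: "m \<le> card (B \<inter> N D0)"
    using CD CB(1) cC card_mono[of "B \<inter> N D0" C] finB by simp
  have half: "m \<le> n" if "k \<le> 2 * n + 1" for n using that m by linarith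
  consider
    (alpha) "card (B \<inter> D0) = 0" "card (B \<inter> co D0) = 0" "card (B \<inter> N D0) \<le> m + 1"
  | (beta1) "card (B \<inter> D0) > 0" "card (B \<inter> co D0) = 0" "card (co B \<inter> co D0) = 0"
      "card (N B \<inter> N D0) = 0" "card (N B \<inter> D0) = m + 1" "card (N B \<inter> co D0) = m"
      "card (B \<inter> N D0) = m + 1" "card (co B \<inter> N D0) = m"
  | (beta2) "card (B \<inter> co D0) > 0" "card (B \<inter> D0) = 0" "card (co B \<inter> D0) = 0"
      "card (N B \<inter> N D0) = 0" "card (N B \<inter> co D0) = m + 1" "card (N B \<inter> D0) = m"
      "card (B \<inter> N D0) = m + 1" "card (co B \<inter> N D0) = m"
    by (rule descent_arith[OF cells(1,2)[unfolded m(1)]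
          half[OF cells(8), unfolded cells(4)] half[OF cells(9), unfolded cells(5)]
          half[OF cells(10), unfolded cells(6)] cells(11,12)[unfolded m(1)]
          corner[OF D0, unfolded m(1)]
          corner[OF fragment_co[OF D0(1)], unfolded N_co[OF D0(1)] m(1), OF D0(2,3)] b2])
  then show thesis
  proof cases
    case beta1
    then show thesis using beta[OF D0] by blast
  next
    case beta2
    show thesis
      by (rule beta[of "co D0"]) (use beta2 D0 in \<open>simp_all add: fragment_co N_co co_co\<close>)
  next
    \<comment> \<open>\<open>B\<close> has at most \<open>m + 1\<close> vertices and turns out to be
      \<open>C\<close> with one more vertex \<open>b\<close>, which has no neighbour in
      \<open>A\<close>. The degree of \<open>b\<close> is then at most \<open>k\<close>, too small
      for \<open>k > 3\<close>.\<close>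
    case alpha
    have cB: "card B \<le> m + 1" using cells(3) alpha by linarith
    have "C \<inter> N A \<noteq> {}"
    proof
      assume "C \<inter> N A = {}"
      then have "N A \<inter> B \<subseteq> B - C" by blast
      then have "card (N A \<inter> B) \<le> card (B - C)" using finB by (intro card_mono) auto
      also have "\<dots> = card B - card C" using CB(1) finB finite_subset by (intro card_Diff_subset) auto
      finally show False using cB cC crA(4) m by linarith
    qed
    note s = full_adjacent[OF fC fA this]
    have "C \<subseteq> N A \<inter> B" using s CB(1) by blast
    moreover have "card C = card (N A \<inter> B)" using crA(4) cC m by linarith
    ultimately have NAB: "N A \<inter> B = C" using card_subset_eq finB by (metis finite_Int)
    have ny: "y \<notin> N C" using adjacent_bad[OF A(1) C \<open>C \<inter> N A \<noteq> {}\<close> leaving_N[OF A(2)]] by blast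
    then have "B \<noteq> C" using B(3) by blast
    then obtain b where b: "b \<in> B" "b \<notin> C" using CB(1) by blast
    have BC: "B = insert b C"
    proof -
      have "card (insert b C) = m + 1" using cC b(2) finB CB(1) finite_subset by (metis Suc_eq_plus1 card_insert_disjoint)
      moreover have "insert b C \<subseteq> B" using b CB(1) by blast
      ultimately show ?thesis using cB card_seteq[OF finB] by metis
    qed
    have "E `` {b} \<subseteq> C \<union> (N B - A)"
    proof
      fix v assume "v \<in> E `` {b}"
      then have v: "(b, v) \<in> E" by blast
      then have "v \<in> (B - {b}) \<union> N B" using E_image_fragment[OF b(1)] by blast
      moreover have "v \<notin> A"
      proof
        assume "v \<in> A"
        moreover have "b \<notin> A" using crA(2) b(1) N_disjoint[of B] by blast
        ultimately have "b \<in> N A" using N_I[OF E_sym[OF v]] by blast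
        then show False using NAB b by blast
      qed
      ultimately show "v \<in> C \<union> (N B - A)" using BC by blast
    qed
    moreover have "finite (C \<union> (N B - A))" using finB CB(1) fin[OF N_subset] finite_subset by blast
    ultimately have "card (E `` {b}) \<le> card (C \<union> (N B - A))" by (rule card_mono[rotated])
    also have "\<dots> \<le> card C + card (N B - A)" by (rule card_Un_le)
    also have "card (N B - A) = card (N B) - card A"
      using crA(2) fin[OF N_subset] finite_subset by (intro card_Diff_subset) blast+
    finally have "card (E `` {b}) \<le> k"
      using cC fragmentD(3)[OF B(1)] m m_def by linarith
    moreover have "3 * k \<le> 2 * card (E `` {b}) + 3"
      using degree fragmentD(1)[OF B(1)] b(1) by blast
    ultimately show thesis using k_gt by linarith
  qed
qed

text \<open>One half of the ring in which the argument ends; the other half is \<open>linked C' d' M' C d M\<close>.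
  The cyclic order is \<open>M, C d, \<dots>, C' d', M'\<close>.\<close>

definition linked :: "'a set \<Rightarrow> 'a \<Rightarrow> 'a set \<Rightarrow> 'a set \<Rightarrow> 'a \<Rightarrow> 'a set \<Rightarrow> bool" where
  "linked C d M C' d' M' \<longleftrightarrow> bad C \<and> (\<exists>c. leaving C c d) \<and> qend M \<and> full M \<and> good M \<and>
     N M = insert d C \<union> M' \<and> N C \<inter> M' = {} \<and> N C \<inter> C' = {} \<and> C \<inter> C' = {} \<and>
     d \<noteq> d' \<and> d \<notin> M' \<and> d \<notin> C'"

text \<open>A tree edge from \<open>M\<close> to a vertex of \<open>C\<close> outside
  \<open>M'\<close> would be contractible by \<open>contractible_between\<close>; but the only
  contractible tree edge leaves the good \<open>M'\<close>, so it has an end there. The exit of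
  \<open>C\<close> is \<open>d\<close>, as \<open>d\<close> lies in both \<open>N C\<close> and
  \<open>N M\<close>.\<close>

lemma linked_exits:
  assumes L: "linked C d M C' d' M'" and L': "linked C' d' M' C d M"
  shows "closed_off Q {d} C" "closed_off Q {d, d'} (M \<union> M')"
proof -
  have aux: "v \<in> M' \<or> v = d"
    if L: "linked C d M C' d' M'" and L': "linked C' d' M' C d M"
      and uv: "(u, v) \<in> Q" "u \<in> M" "v \<notin> M" for u v C d M C' d' M'
  proof (rule ccontr)
    assume neg: "\<not> ?thesis"
    have fC: "qend C" "full C" using L badD(1) bad_full by (auto simp: linked_def)
    have fM: "qend M" "full M" using L by (auto simp: linked_def)
    have NM: "N M = insert d C \<union> M'" using L by (simp add: linked_def)
    have "v \<in> N M" using N_I[OF Q_E[OF uv(1)]] uv by blast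
    then have vC: "v \<in> C" using NM neg by blast
    have "C \<inter> N M \<noteq> {}" using vC NM by blast
    then have "M \<inter> N C \<noteq> {}" using full_adjacent(2)[OF fC(2) fM(2)] uv(2) by blast
    then have K: "{u, v} \<in> K" using contractible_between[OF fM fC _ uv(1,2) vC] by blast
    obtain a' b' where ab': "leaving M' a' b'" "{a', b'} \<in> K" using L' by (auto simp: linked_def good_def)
    have "(a', b') \<in> Q" using ab' by (simp add: leaving_def)
    then have "{a', b'} = {u, v}" by (rule unique[OF _ ab'(2) uv(1) K])
    then have "a' \<in> {u, v}" by blast
    moreover have "u \<notin> M'" using L uv(2) N_disjoint[of M] NM by blast
    ultimately have "v \<in> M'" using ab'(1) unfolding leaving_def by blast
    then show False using neg by blast
  qed
  show "closed_off Q {d, d'} (M \<union> M')"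
    using aux[OF L L'] aux[OF L' L] unfolding closed_off_def by blast
  have "d \<in> N C" using L leaving_N by (auto simp: linked_def)
  moreover have "d \<in> N M" "bad C" "qend M" "full M" "C \<inter> N M \<noteq> {}"
    using L fragmentD(2)[OF fullD(1)[OF bad_full]] by (auto simp: linked_def)
  ultimately show "closed_off Q {d} C" using closed_off_exit by blast
qed

text \<open>The two-exit lemmas apply to \<open>X = M \<union> M'\<close>, any \<open>u\<close> in
  \<open>M\<close> and some \<open>w\<close> in \<open>N C\<close> other than \<open>d\<close>,
  \<open>d'\<close> and the vertices of \<open>M\<close>; it exists because
  \<open>k = 2 * card M + 1\<close> exceeds \<open>card M + 2\<close>.\<close>

lemma linked_root:
  assumes L: "linked C d M C' d' M'" and L': "linked C' d' M' C d M" and r: "r \<notin> C"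
  shows "r \<notin> C'" "(r, d) \<notin> reach Q {d'}"
proof -
  note ex = linked_exits[OF L L'] and ex' = linked_exits[OF L' L]
  have bC: "bad C" and fM: "full M" and NM: "N M = insert d C \<union> M'"
    and nC: "N C \<inter> M' = {}" "N C \<inter> C' = {}" "C \<inter> C' = {}" and d: "d \<noteq> d'" "d \<notin> M'" "d \<notin> C'"
    using L by (auto simp: linked_def)
  have NM': "N M' = insert d' C' \<union> M" and d': "d' \<notin> M" "d' \<notin> C"
    using L' by (auto simp: linked_def)
  have dC: "d \<notin> C" "d \<in> N C" using L leaving_N by (auto simp: linked_def leaving_def)
  have dC': "d' \<notin> C'" "d' \<in> N C'" using L' leaving_N by (auto simp: linked_def leaving_def)
  note fC = bad_full[OF bC]
  have "C \<inter> N M \<noteq> {}" using NM fragmentD(2)[OF fullD(1)[OF fC]] by blast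
  note s = full_adjacent[OF fC fM this]
  have dM: "d \<notin> M" using NM N_disjoint by blast
  obtain u where u: "u \<in> M" using fragmentD(2)[OF fullD(1)[OF fM]] by blast
  have uC': "u \<notin> C'" using NM' u N_disjoint[of M'] s(2) nC(2) by blast
  have "\<not> N C \<subseteq> insert d (insert d' M)"
  proof
    assume "N C \<subseteq> insert d (insert d' M)"
    moreover have f: "finite M" using fin fragmentD(1) fullD(1) fM by blast
    ultimately have "k \<le> card (insert d (insert d' M))"
      using card_mono[of "insert d (insert d' M)" "N C"] fragmentD(3)[OF fullD(1)[OF fC]] by simp
    also have "\<dots> \<le> card M + 2" using f by (simp add: card_insert_if)
    finally show False using fullD(2,3)[OF fM] by linarith
  qed
  then obtain w where w: "w \<in> N C" "w \<noteq> d" "w \<noteq> d'" "w \<notin> M" by blast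
  have wX: "w \<notin> M \<union> M'" "w \<notin> C'" using w nC by blast+
  obtain c where c: "c \<in> C" "(c, u) \<in> E" "u \<notin> C" using s(2) u N_E by blast
  obtain c' where c': "c' \<in> C" "(c', w) \<in> E" "w \<notin> C" using w(1) N_E by blast
  have V: "d \<in> V" "d' \<in> V" using dC dC' N_subset by blast+
  have ud: "u \<noteq> d" "u \<noteq> d'" using u dM d' by blast+
  have uX: "u \<in> M \<union> M'" using u by blast
  show "(r, d) \<notin> reach Q {d'}"
    by (rule two_exits_separate[OF ex(2) uX wX(1) ex(1) dC(1) r V(1) c ud(1) c' w(2)])
  show "r \<notin> C'"
    by (rule two_exits_root[OF ex(2) uX wX(1) ex(1) dC(1) r V(1) c ud(1) c' w(2)
          ex'(1) dC'(1) V(2) d(1) ud(2) w(3) uC' wX(2)])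
qed

text \<open>The root misses one of the disjoint cliques \<open>C\<close> and \<open>C'\<close>,
  hence both by \<open>linked_root\<close>; then \<open>d\<close> and \<open>d'\<close> would be
  proper ancestors of each other.\<close>

lemma linked_False:
  assumes L: "linked C d M C' d' M'" and L': "linked C' d' M' C d M"
  shows False
proof -
  have "r \<notin> C \<or> r \<notin> C'" using L by (auto simp: linked_def)
  then have r: "r \<notin> C" "r \<notin> C'" using linked_root(1) L L' by blast+
  have "d \<in> N C" "d \<noteq> d'" using L leaving_N by (auto simp: linked_def)
  then have "d \<in> V" using N_subset by blast
  then show False
    using separates_antisym[OF linked_root(2)[OF L L' r(1)]] linked_root(2)[OF L' L r(2)]
      \<open>d \<noteq> d'\<close> by blast
qed

section \<open>Closing the ring: there are no triples\<close>

lemma minimal_triple: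
  assumes "triple A x y B"
  shows "\<exists>A' x' y' B'. triple A' x' y' B' \<and> B' \<subseteq> B \<and>
    (\<forall>A'' x'' y'' B''. triple A'' x'' y'' B'' \<longrightarrow> \<not> B'' \<subset> B')"
proof -
  have "finite B" using assms fin fragmentD(1) by (auto simp: triple_def)
  then have "(\<exists>A x y. triple A x y B) \<longrightarrow> (\<exists>A' x' y' B'. triple A' x' y' B' \<and> B' \<subseteq> B \<and>
    (\<forall>A'' x'' y'' B''. triple A'' x'' y'' B'' \<longrightarrow> \<not> B'' \<subset> B'))"
  proof (induction B rule: finite_psubset_induct)
    case (psubset B)
    show ?case
    proof (cases "\<forall>A'' x'' y'' B''. triple A'' x'' y'' B'' \<longrightarrow> \<not> B'' \<subset> B")
      case False
      then obtain A'' x'' y'' B'' where t: "triple A'' x'' y'' B''" "B'' \<subset> B" by blast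
      show ?thesis using psubset.IH[OF t(2)] t by (meson psubset_imp_subset subset_trans)
    qed blast
  qed
  then show ?thesis using assms by blast
qed

text \<open>From a minimal triple, \<open>descent\<close> gives one half of the ring. If
  \<open>co B\<close> and \<open>co M\<close> are disjoint, \<open>co B\<close> is the second
  clique, with \<open>A\<close> as its bad neighbour. Otherwise the corner
  \<open>co B \<inter> co M\<close> carries a triple, and \<open>descent\<close> inside it gives the
  other half.\<close>

lemma no_triple: "\<not> triple A0 x0 y0 B0"
proof
  assume "triple A0 x0 y0 B0"
  then obtain A x y B where T: "triple A x y B"
    and min: "\<forall>A'' x'' y'' B''. triple A'' x'' y'' B'' \<longrightarrow> \<not> B'' \<subset> B"
    using minimal_triple by meson
  have A: "bad A" "leaving A x y" and B: "fragment B" "x \<in> N B" "y \<in> N B"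
    using T by (auto simp: triple_def)
  note fA = bad_full[OF A(1)]
  obtain C c d M where C: "bad C" "C \<subseteq> B" "leaving C c d" "d \<in> B"
    and M: "qend M" "full M" "good M" and NB: "N B = insert y A \<union> M" and coM: "insert y A \<subseteq> co M"
    and BM: "B \<inter> N M = insert d C" and c': "2 * card (co B \<inter> N M) + 1 = k"
    and BMN: "N B \<inter> N M = {}" and AC: "A \<inter> N C = {}"
    by (rule descent[OF T min])
  note fC = bad_full[OF C(1)]
  define M' where "M' = co B \<inter> N M"
  have NM: "N M = insert d C \<union> M'"
    using BM BMN N_subset[of M] unfolding M'_def by (auto simp: co_def)
  have cBM: "co B \<inter> M = {}" using NB by (auto simp: co_def)
  have fragM: "fragment M" using fullD(1)[OF M(2)] .
  have AM: "A \<inter> N M = {}" using coM by (auto simp: co_def)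
  have NAM: "N A \<inter> M = {}" using full_nonadjacent_sym[OF fA M(2) AM] by blast
  \<comment> \<open>\<open>M\<close> is good, so no good fragment lies on the other side of its
    separator.\<close>
  have ends: "bad F" if "qend F" "F \<subseteq> co M" for F
    using good_both_sides[OF fragM order_refl M(3) that(2)] that(1) by (auto simp: bad_def)
  have BcB: "B \<inter> co B = {}" by (auto simp: co_def)
  have NCcB: "N C \<inter> co B = {}" using no_edge_co C(2) by (blast elim: N_E)
  show False
  proof (cases "co B \<inter> co M = {}")
    case True
    then have eq: "co B = M'" using cBM unfolding M'_def by (auto simp: co_def)
    have fM': "full M'" using fragment_co[OF B(1)] c' eq unfolding full_def M'_def by simp
    have NM': "N M' = insert y A \<union> M" using N_co[OF B(1)] eq NB by simp
    have "(x, y) \<in> Q" using A(2) by (simp add: leaving_def)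
    then have qM': "qend M'"
      using full_qend[OF fM'] qfragmentI[OF fullD(1)[OF fM']] B(2,3) N_co[OF B(1)] eq by metis
    have "good M'"
    proof (rule ccontr)
      assume "\<not> good M'"
      then have "bad M'" using qM' by (simp add: bad_def)
      moreover have "A \<inter> N M' \<noteq> {}" using NM' fragmentD(2)[OF fullD(1)[OF fA]] by blast
      ultimately show False using adjacent_bad[OF _ A(1)] NM' leaving_N[OF A(2)] by blast
    qed
    have AB: "A \<inter> B = {}" "y \<notin> B" using NB N_disjoint[of B] by blast+
    have CA: "C \<inter> N A = {}" using full_nonadjacent_sym[OF fA fC AC] .
    have "linked C d M A y M'"
      unfolding linked_def using C M NM NCcB eq AC AB BcB by blast
    moreover have "linked A y M' C d M"
      unfolding linked_def using A C(2) qM' fM' \<open>good M'\<close> NM' NAM CA AB coM C(4) N_disjoint[of M]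
      by (auto simp: co_def)
    ultimately show False by (rule linked_False)
  next
    case False
    define F where "F = co B \<inter> co M"
    have "N (co B) \<inter> co M = insert y A"
      unfolding N_co[OF B(1)] NB using coM by (auto simp: co_def)
    moreover have yA: "y \<notin> A" using A(2) by (simp add: leaving_def)
    moreover have finA: "finite A" using fin fragmentD(1) fullD(1) fA by blast
    ultimately have "card (N (co B) \<inter> co M) = card A + 1" by simp
    moreover have "N (co B) \<inter> N (co M) = {}" using BMN N_co[OF B(1)] N_co[OF fragM] by simp
    \<comment> \<open>With \<open>k = 2 * card A + 1\<close>, the three parts have
      \<open>card A\<close>, 0 and \<open>card A + 1\<close> elements.\<close>
    ultimately have le: "card (co B \<inter> N (co M)) + card (N (co B) \<inter> N (co M)) + card (N (co B) \<inter> co M) \<le> k"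
      using c' fullD(2)[OF fA] N_co[OF fragM] by simp
    note fr = corner_fragment[OF fragment_co[OF B(1)] False le]
    have FB: "F \<subseteq> co B" "F \<subseteq> co M" unfolding F_def by blast+
    have NF: "N F = M' \<union> insert y A"
      using fr(2) \<open>N (co B) \<inter> co M = insert y A\<close> \<open>N (co B) \<inter> N (co M) = {}\<close> N_co[OF fragM]
      unfolding F_def M'_def by simp
    have "x \<in> N F" "y \<in> N F" using NF A(2) by (auto simp: leaving_def)
    then have "triple A x y F"
      using A fr(1) ends FB(2) unfolding triple_def F_def by blast
    from minimal_triple[OF this] obtain A1 x1 y1 B1 where T1: "triple A1 x1 y1 B1" and B1F: "B1 \<subseteq> F"
      and min1: "\<forall>A'' x'' y'' B''. triple A'' x'' y'' B'' \<longrightarrow> \<not> B'' \<subset> B1"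
      by meson
    obtain C1 c1 d1 M1 where C1: "bad C1" "C1 \<subseteq> B1" "leaving C1 c1 d1" "d1 \<in> B1"
      and M1: "qend M1" "full M1" "good M1" and NB1: "N B1 = insert y1 A1 \<union> M1" and "insert y1 A1 \<subseteq> co M1"
      and BM1: "B1 \<inter> N M1 = insert d1 C1" and c1: "2 * card (co B1 \<inter> N M1) + 1 = k"
      and BMN1: "N B1 \<inter> N M1 = {}" and "A1 \<inter> N C1 = {}"
      by (rule descent[OF T1 min1])
    have M1sub: "M1 \<subseteq> F \<union> M' \<union> insert y A" using NB1 NF B1F by (auto simp: nbhd_def)
    have M1M: "M1 \<inter> M = {}"
      using M1sub FB coM cBM unfolding M'_def by (auto simp: co_def)
    obtain u u' where u: "leaving M u u'" "{u, u'} \<in> K" using M(3) by (auto simp: good_def)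
    obtain v v' where v: "leaving M1 v v'" "{v, v'} \<in> K" using M1(3) by (auto simp: good_def)
    \<comment> \<open>The single contractible tree edge leaves both \<open>M\<close> and
      \<open>M1\<close>; these are disjoint, so it joins them.\<close>
    have "{u, u'} = {v, v'}" using unique u v by (auto simp: leaving_def)
    then have "v = u'" using u v M1M by (auto simp: leaving_def doubleton_eq_iff)
    then have "M1 \<inter> N M \<noteq> {}" using leaving_N[OF u(1)] v(1) by (auto simp: leaving_def)
    note s = full_adjacent[OF M1(2) M(2) this]
    have "insert y A \<inter> B = {}" using NB N_disjoint[of B] by blast
    then have "M1 \<inter> B = {}" using M1sub FB(1) unfolding M'_def by (auto simp: co_def)
    \<comment> \<open>Equal sizes make \<open>M1\<close> all of \<open>M'\<close>, and likewise
      \<open>M\<close> all of \<open>co B1 \<inter> N M1\<close>: both descents end in the same pair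
      of cliques.\<close>
    then have "M1 \<subseteq> M'" using s(1)[unfolded NM] C(2,4) by blast
    moreover have "card M1 = card M'" using c' fullD(2)[OF M1(2)] unfolding M'_def by linarith
    moreover have "finite M'" "finite (co B1 \<inter> N M1)" unfolding M'_def using fin[OF co_subset] by auto
    ultimately have M1eq: "M1 = M'" using card_subset_eq by blast
    have B1M: "B1 \<subseteq> co M" "B1 \<subseteq> co B" using B1F FB by blast+
    have NM1: "N M1 = insert d1 C1 \<union> (co B1 \<inter> N M1)"
      using BM1 BMN1 N_subset[of M1] by (auto simp: co_def)
    have "M \<inter> B1 = {}" using B1M by (auto simp: co_def)
    then have "M \<subseteq> co B1 \<inter> N M1" using subset_trans[OF s(2) equalityD1[OF NM1]] C1(2,4) by blast
    moreover have "card M = card (co B1 \<inter> N M1)" using c1 fullD(2)[OF M(2)] by linarith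
    ultimately have Meq: "M = co B1 \<inter> N M1"
      using card_subset_eq \<open>finite (co B1 \<inter> N M1)\<close> by blast
    have NC1: "N C1 \<inter> M = {}"
    proof (rule ccontr)
      assume "N C1 \<inter> M \<noteq> {}"
      then obtain a b where "a \<in> C1" "(a, b) \<in> E" "b \<in> M" by (blast elim: N_E)
      then show False using no_edge_co[of b M a] E_sym C1(2) B1M(1) by blast
    qed
    have NC1C: "N C1 \<inter> C = {}"
    proof (rule ccontr)
      assume "N C1 \<inter> C \<noteq> {}"
      then obtain a b where "a \<in> C1" "(a, b) \<in> E" "b \<in> C" by (blast elim: N_E)
      then show False using no_edge_co[of b B a] E_sym C1(2) C(2) B1M(2) by blast
    qed
    have C1cB: "C1 \<subseteq> co B" "d1 \<in> co B" using C1 B1M(2) by blast+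
    have "linked C d M C1 d1 M1"
      unfolding linked_def using C M NM M1eq NCcB C1cB BcB M'_def by blast
    moreover have "d1 \<notin> M" using C1(4) \<open>M \<inter> B1 = {}\<close> by blast
    then have "linked C1 d1 M1 C d M"
      unfolding linked_def using C1 M1 NM1 Meq[symmetric] NC1 NC1C C1cB C(2,4) BcB by auto
    ultimately show False by (rule linked_False)
  qed
qed

text \<open>Otherwise all tree edges coincide and the spanning tree covers only two vertices, while
  the root has degree at least 5.\<close>

lemma ex_noncontractible: "\<exists>x y. (x, y) \<in> Q \<and> {x, y} \<notin> K"
proof (rule ccontr)
  assume "\<not> ?thesis"
  then have K: "{x, y} \<in> K" if "(x, y) \<in> Q" for x y using that by blast
  have big: "5 \<le> card (E `` {r})" using degree[OF r_V] k_gt by linarith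
  have edge: "\<exists>u. (u, v) \<in> Q" if "v \<in> V" "v \<noteq> r" for v
    using connected[OF that(1)] that(2) by (auto elim: rtranclE)
  have "E `` {r} \<noteq> {}" using big by force
  then obtain v where v: "v \<in> V" "v \<noteq> r" using E_V E_neq by blast
  obtain a where av: "(a, v) \<in> Q" using edge[OF v] by blast
  have "E `` {r} \<subseteq> {a, v}"
  proof
    fix w assume "w \<in> E `` {r}"
    then have "w \<in> V" "w \<noteq> r" using E_V E_neq by blast+
    then obtain b where "(b, w) \<in> Q" using edge by blast
    then have "{b, w} = {a, v}" using unique av K by blast
    then show "w \<in> {a, v}" by blast
  qed
  then have "card (E `` {r}) \<le> card {a, v}" by (intro card_mono) auto
  also have "\<dots> \<le> 2" by (simp add: card_insert_if)
  finally show False using big by simp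
qed

text \<open>By \<open>good_both_sides\<close> every separator has a side whose minimal fragments are
  all bad. A separator through a noncontractible tree edge thus yields a bad \<open>A\<close>, and
  then one through a tree edge leaving \<open>A\<close> yields a triple.\<close>

lemma contradiction: False
proof -
  obtain x y where xy: "(x, y) \<in> Q" "{x, y} \<notin> K" using ex_noncontractible by blast
  then obtain B0 where B0: "fragment B0" "x \<in> N B0" "y \<in> N B0" using noncontractible by blast
  have side: "\<exists>B'. fragment B' \<and> N B' = N B \<and> (\<forall>F. F \<subseteq> B' \<longrightarrow> qend F \<longrightarrow> bad F)"
    if "fragment B" for B
  proof (cases "\<forall>F. F \<subseteq> B \<longrightarrow> qend F \<longrightarrow> bad F")
    case False
    then obtain F where "F \<subseteq> B" "good F" by (auto simp: bad_def)
    then have "\<forall>F'. F' \<subseteq> co B \<longrightarrow> qend F' \<longrightarrow> bad F'"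
      using good_both_sides[OF that] by (auto simp: bad_def)
    then show ?thesis using fragment_co[OF that] N_co[OF that] by blast
  qed (use that in blast)
  obtain B1 where B1: "fragment B1" "N B1 = N B0" "\<forall>F. F \<subseteq> B1 \<longrightarrow> qend F \<longrightarrow> bad F"
    using side[OF B0(1)] by blast
  then have "qfragment B1" using qfragmentI[OF B1(1) xy(1)] B0 by simp
  then obtain A where "A \<subseteq> B1" "qend A" by (rule ex_qend)
  then have A: "bad A" using B1(3) by blast
  obtain a b where ab: "leaving A a b" using ex_leaving[OF qend_fragment[OF badD(1)[OF A]]] .
  obtain B where B: "fragment B" "a \<in> N B" "b \<in> N B" using bad_leaving[OF A ab] .
  obtain B' where "fragment B'" "N B' = N B" "\<forall>F. F \<subseteq> B' \<longrightarrow> qend F \<longrightarrow> bad F"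
    using side[OF B(1)] by blast
  then have "triple A a b B'" using A ab B unfolding triple_def by simp
  then show False using no_triple by blast
qed

end

section \<open>Contraction and depth-first trees in the graph library\<close>

lemma arcs_ends_induce:
  "arcs_ends (with_proj G \<restriction> S) = {(u, v) \<in> parcs G. u \<in> S \<and> v \<in> S}"
  by (auto simp: arcs_ends_conv)

lemma connected_closed_off:
  assumes con: "connected H" and a: "a \<in> X" "a \<in> verts H" and b: "b \<in> verts H"
    and closed: "\<And>u v. (u, v) \<in> arcs_ends H \<Longrightarrow> u \<in> verts H \<Longrightarrow> v \<in> verts H \<Longrightarrow> u \<in> X \<longleftrightarrow> v \<in> X"
  shows "b \<in> X"
proof -
  have "(a, b) \<in> rtrancl_on (verts H) ((arcs_ends H)\<^sup>s)"
    using con a b unfolding connected_conv by blast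
  then show ?thesis
  proof (induction rule: rtrancl_on_induct)
    case (step y z)
    then have "(y, z) \<in> arcs_ends H \<or> (z, y) \<in> arcs_ends H" by (auto simp: symcl_def)
    then show ?case using closed step by blast
  qed (rule a)
qed

text \<open>Deleting the neighbourhood of \<open>F\<close> cuts \<open>F\<close> off from a
  remaining vertex.\<close>

lemma nbhd_ge_of_k_connected:
  assumes G: "pair_graph G" and con: "k_connected k G"
    and F: "F \<subseteq> pverts G" "F \<noteq> {}" "F \<union> nbhd (parcs G) F \<noteq> pverts G"
  shows "k \<le> card (nbhd (parcs G) F)"
proof (rule ccontr)
  interpret pair_graph G by fact
  let ?N = "nbhd (parcs G) F"
  let ?H = "with_proj G \<restriction> (pverts G - ?N)"
  assume "\<not> k \<le> card ?N"
  moreover have sub: "?N \<subseteq> pverts G" by (auto simp: nbhd_def dest: in_arcsD2)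
  ultimately have con: "connected ?H" using con by (auto simp: k_connected_def)
  obtain a where a: "a \<in> F" using F by blast
  obtain b where b: "b \<in> pverts G" "b \<notin> F" "b \<notin> ?N" using F sub by blast
  have "b \<in> F"
  proof (rule connected_closed_off[OF con a])
    fix u v assume "(u, v) \<in> arcs_ends ?H" "u \<in> verts ?H" "v \<in> verts ?H"
    then show "u \<in> F \<longleftrightarrow> v \<in> F"
      unfolding arcs_ends_induce by (auto simp: nbhd_def dest: arcs_symmetric)
  qed (use a b F in \<open>auto simp: nbhd_def\<close>)
  then show False using b by blast
qed

lemma inj_on_contract_class: "inj_on (contract_class {x, y}) (- {y})"
  by (auto simp: inj_on_def contract_class_def split: if_splits)

lemma contract_arc:
  assumes "(u, v) \<in> parcs G" "contract_class e u \<noteq> contract_class e v"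
  shows "(contract_class e u, contract_class e v) \<in> parcs (contract G e)"
  using assms by (auto simp: contract_def)

text \<open>A separator \<open>T\<close> of \<open>G/xy\<close> lifts to a separator of \<open>G\<close> with at most one vertex more, and with
  one more only if it contains both ends of the contracted edge.\<close>

lemma not_contractible_separator:
  assumes G: "pair_graph G" and con: "k_connected k G" and big: "k + 1 < card (pverts G)"
    and xy: "(x, y) \<in> parcs G" and nc: "\<not> k_connected k (contract G {x, y})"
  obtains F where "F \<subseteq> pverts G" "F \<noteq> {}" "F \<union> nbhd (parcs G) F \<noteq> pverts G"
    "card (nbhd (parcs G) F) = k" "x \<in> nbhd (parcs G) F" "y \<in> nbhd (parcs G) F"
proof -
  interpret pair_graph G by fact
  let ?c = "contract_class {x, y}"
  let ?H = "contract G {x, y}"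
  let ?N = "nbhd (parcs G)"
  have V: "x \<in> pverts G" "y \<in> pverts G" using xy in_arcsD1 in_arcsD2 by auto
  \<comment> \<open>Contraction merges only \<open>x\<close> with \<open>y\<close>, so it is
    injective once either end is removed.\<close>
  have card_le: "card (S - {z}) \<le> card T"
    if "S \<subseteq> pverts G" "?c ` S \<subseteq> T" "finite T" "z \<in> {x, y}" for S T z
  proof (rule card_inj_on_le)
    have "{x, y} = {y, x}" by blast
    then have "inj_on ?c (- {z})"
      using inj_on_contract_class[of x y] inj_on_contract_class[of y x] that(4) by auto
    then show "inj_on ?c (S - {z})" by (rule inj_on_subset) auto
  qed (use that in auto)
  have pvH: "pverts ?H = ?c ` pverts G" by (simp add: contract_def)
  have finH: "finite (pverts ?H)" unfolding pvH using pair_finite_verts by simp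
  have "card (pverts G - {y}) \<le> card (pverts ?H)" using card_le[of "pverts G" "pverts ?H" y] finH pvH by auto
  then have cH: "card (pverts ?H) > k" using big V pair_finite_verts by simp
  then obtain T where T: "T \<subseteq> pverts ?H" "card T < k"
    and ncon: "\<not> connected (with_proj ?H \<restriction> (pverts ?H - T))"
    using nc by (auto simp: k_connected_def)
  let ?W = "pverts ?H - T"
  let ?R = "(arcs_ends (with_proj ?H \<restriction> ?W))\<^sup>s"
  have finT: "finite T" using T finH finite_subset by blast
  have "\<not> pverts ?H \<subseteq> T" using card_mono[OF finT, of "pverts ?H"] T cH by auto
  then have "?W \<noteq> {}" by blast
  then obtain a b where ab: "a \<in> ?W" "b \<in> ?W" "(a, b) \<notin> rtrancl_on ?W ?R"
    using ncon unfolding connected_conv by auto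
  \<comment> \<open>The vertices whose classes lie in the component of \<open>a\<close> in the
    contraction minus \<open>T\<close>.\<close>
  define F where "F = {v \<in> pverts G. (a, ?c v) \<in> rtrancl_on ?W ?R}"
  define S where "S = {v \<in> pverts G. ?c v \<in> T}"
  have finS: "finite S" unfolding S_def using pair_finite_verts by auto
  have N_S: "?N F \<subseteq> S"
  proof
    fix v assume "v \<in> ?N F"
    then obtain u where u: "u \<in> F" "(u, v) \<in> parcs G" "v \<notin> F" by (auto simp: nbhd_def)
    have v: "v \<in> pverts G" using u in_arcsD2 by blast
    show "v \<in> S"
    proof (rule ccontr)
      assume "v \<notin> S"
      then have vW: "?c v \<in> ?W" using v pvH by (auto simp: S_def)
      have ur: "(a, ?c u) \<in> rtrancl_on ?W ?R" using u by (simp add: F_def)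
      then have uW: "?c u \<in> ?W" by (rule in_rtrancl_on_in_F)
      have "(a, ?c v) \<in> rtrancl_on ?W ?R"
      proof (cases "?c u = ?c v")
        case False
        then have "(?c u, ?c v) \<in> ?R"
          using contract_arc[OF u(2)] uW vW unfolding arcs_ends_induce by (auto simp: symcl_def)
        then show ?thesis using ur vW by (auto intro: rtrancl_on_into_rtrancl_on)
      qed (use ur in simp)
      then show False using u v by (simp add: F_def)
    qed
  qed
  obtain va vb where va: "va \<in> pverts G" "a = ?c va" and vb: "vb \<in> pverts G" "b = ?c vb"
    using ab pvH by auto
  have "va \<in> F" using va ab by (auto simp: F_def)
  have "vb \<notin> F" "vb \<notin> S" using vb ab by (auto simp: F_def S_def)
  then have ne: "F \<union> ?N F \<noteq> pverts G" using vb N_S by blast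
  have F: "F \<subseteq> pverts G" "F \<noteq> {}" using \<open>va \<in> F\<close> by (auto simp: F_def)
  have kN: "k \<le> card (?N F)" by (rule nbhd_ge_of_k_connected[OF G con F ne])
  have NS: "card (?N F) \<le> card S" using N_S finS by (intro card_mono)
  \<comment> \<open>If \<open>z\<close> were not in \<open>S\<close>, then
    \<open>card S \<le> card T < k\<close>. So both ends lie in \<open>S\<close>, and
    \<open>k \<le> card S \<le> card T + 1\<close> leaves only \<open>card S = k\<close>.\<close>
  have mem: "z \<in> S \<and> card S = k" if "z \<in> {x, y}" for z
  proof -
    have le: "card (S - {z}) \<le> card T"
      by (rule card_le[OF _ _ finT that]) (auto simp: S_def)
    have "z \<in> S"
    proof (rule ccontr)
      assume "z \<notin> S"
      then show False using le kN NS T by simp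
    qed
    then have "card S \<le> card T + 1" using le finS by simp
    then show ?thesis using \<open>z \<in> S\<close> kN NS T by linarith
  qed
  then have "?N F = S" using card_seteq[OF finS N_S] kN by auto
  then show thesis using that[OF F ne] mem by auto
qed

section \<open>Degrees and depth-first trees in terms of relations\<close>

lemma out_degree_eq_card_Image: "out_degree (with_proj G) v = card (parcs G `` {v})"
proof -
  have "parcs G `` {v} = snd ` out_arcs (with_proj G) v" by (force simp: out_arcs_def)
  moreover have "inj_on snd (out_arcs (with_proj G) v)" by (auto simp: inj_on_def out_arcs_def)
  ultimately show ?thesis by (simp add: out_degree_def card_image)
qed

lemma reachable_induce:
  assumes Q: "Q \<subseteq> V \<times> V" "parcs G = Q" and u: "u \<in> V" "u \<noteq> z"
  shows "u \<rightarrow>\<^sup>*\<^bsub>with_proj G \<restriction> (V - {z})\<^esub> v \<longleftrightarrow> (u, v) \<in> reach Q {z}"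
proof
  assume "u \<rightarrow>\<^sup>*\<^bsub>with_proj G \<restriction> (V - {z})\<^esub> v"
  then have "(u, v) \<in> rtrancl_on (V - {z}) {(u, v) \<in> parcs G. u \<in> V - {z} \<and> v \<in> V - {z}}"
    unfolding reachable_def arcs_ends_induce by simp
  then show "(u, v) \<in> reach Q {z}"
    by (induction rule: rtrancl_on_induct) (use Q in \<open>auto intro: reach_step\<close>)
next
  assume "(u, v) \<in> reach Q {z}"
  then have "(u, v) \<in> rtrancl_on (V - {z}) {(u, v) \<in> parcs G. u \<in> V - {z} \<and> v \<in> V - {z}}"
    by (induction rule: reach_induct) (use Q u in \<open>auto intro: rtrancl_on_into_rtrancl_on\<close>)
  then show "u \<rightarrow>\<^sup>*\<^bsub>with_proj G \<restriction> (V - {z})\<^esub> v"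
    unfolding reachable_def arcs_ends_induce by simp
qed

text \<open>A path from \<open>a\<close> to \<open>b\<close> off \<open>z\<close> closes through
  \<open>z\<close> to a cycle, whose length is at least 3 because
  \<open>a \<noteq> b\<close>.\<close>

lemma no_cycle_unique_branch:
  assumes Q: "pair_graph Q"
    and nocyc: "\<not> (\<exists>p. pre_digraph.cycle (with_proj Q) p \<and> length p \<ge> 3)"
    and za: "(z, a) \<in> parcs Q" and zb: "(z, b) \<in> parcs Q"
    and ab: "(a, b) \<in> reach (parcs Q) {z}"
  shows "a = b"
proof (rule ccontr)
  assume ne: "a \<noteq> b"
  interpret Q: pair_graph Q by fact
  define P where "P = \<lparr> pverts = pverts Q - {z}, parcs = {(u, v) \<in> parcs Q. u \<noteq> z \<and> v \<noteq> z} \<rparr>"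
  interpret P: pair_wf_digraph P
    by unfold_locales (auto simp: P_def dest: Q.in_arcsD1 Q.in_arcsD2)
  have a: "a \<in> pverts P" using za Q.in_arcsD2 Q.no_loops' by (force simp: P_def)
  have "a \<rightarrow>\<^sup>*\<^bsub>with_proj P\<^esub> b"
    using ab
  proof (induction rule: reach_induct)
    case (step u v)
    then have "(u, v) \<in> parcs P" by (auto simp: P_def)
    then show ?case using step.IH P.in_arcsD2[of u v]
      unfolding reachable_def by (auto intro: rtrancl_on_into_rtrancl_on)
  qed (use a in \<open>auto simp: reachable_def\<close>)
  then obtain p where p: "P.apath a p b" using P.reachable_apath by blast
  then have set_p: "set p \<subseteq> parcs Q" and cas: "pcas a p b" and dist: "distinct (pawalk_verts a p)"
    unfolding P.apath_def P.awalk_def by (auto simp: P_def)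
  have "set (pawalk_verts a p) \<subseteq> pverts P"
    using P.awalk_verts_in_verts[OF a] p unfolding P.apath_def P.awalk_def by blast
  then have z: "z \<notin> set (pawalk_verts a p)" by (auto simp: P_def)
  have pne: "p \<noteq> []" using cas ne by auto
  have bz: "(b, z) \<in> parcs Q" using zb Q.arcs_symmetric by blast
  define c where "c = (z, a) # p @ [(b, z)]"
  have cas': "pcas a (p @ [(b, z)]) z" using cas by (induction p arbitrary: a) auto
  have verts': "pawalk_verts a (p @ [(b, z)]) = pawalk_verts a p @ [z]"
    using cas by (induction p arbitrary: a) auto
  have "Q.awalk z c z"
    unfolding Q.awalk_def c_def using set_p cas' za bz Q.in_arcsD1 by auto
  moreover have "tl (pawalk_verts z c) = pawalk_verts a p @ [z]"
    unfolding c_def by (simp add: verts')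
  ultimately have "Q.cycle c" unfolding Q.cycle_def using dist z by (auto simp: c_def)
  moreover have "length c \<ge> 3" using pne by (cases p) (auto simp: c_def)
  ultimately show False using nocyc by blast
qed

lemma dfs_relation_of_dfs_tree:
  assumes G: "pair_graph G" and D: "dfs_tree Q r G"
  shows "dfs_relation (pverts G) (parcs G) (parcs Q) r" "parcs Q \<subseteq> parcs G"
proof -
  interpret G: pair_graph G by fact
  have T: "spanning_utree Q G" and r: "r \<in> pverts G" using D by (auto simp: dfs_tree_def)
  have pQ: "pair_graph Q" and con: "connected (with_proj Q)"
    and nocyc: "\<not> (\<exists>p. pre_digraph.cycle (with_proj Q) p \<and> length p \<ge> 3)"
    using T by (auto simp: spanning_utree_def)
  have V: "pverts Q = pverts G" and sub: "parcs Q \<subseteq> parcs G"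
    using T by (auto simp: spanning_utree_def spanning_def subgraph_def)
  interpret Q: pair_graph Q by fact
  have symQ: "sym (parcs Q)" using Q.arcs_symmetric by (auto intro: symI)
  have QV: "parcs Q \<subseteq> pverts G \<times> pverts G" using V Q.in_arcsD1 Q.in_arcsD2 by auto
  show "parcs Q \<subseteq> parcs G" by (rule sub)
  show "dfs_relation (pverts G) (parcs G) (parcs Q) r"
  proof
    show "finite (pverts G)" by (rule G.pair_finite_verts)
    show "parcs G \<subseteq> pverts G \<times> pverts G" using G.in_arcsD1 G.in_arcsD2 by auto
    show "sym (parcs Q)" by (rule symQ)
    show "r \<in> pverts G" by (rule r)
    show "parcs Q \<subseteq> pverts G \<times> pverts G" by (rule QV)
    show "a = b" if "(z, a) \<in> parcs Q" "(z, b) \<in> parcs Q" "(a, b) \<in> reach (parcs Q) {z}" for z a b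
      by (rule no_cycle_unique_branch[OF pQ nocyc that])
    show "(r, v) \<in> (parcs Q)\<^sup>*" if "v \<in> pverts G" for v
    proof -
      have "v \<in> {v. (r, v) \<in> (parcs Q)\<^sup>*}"
        by (rule connected_closed_off[OF con, of r])
          (use r that V in \<open>auto dest: Q.arcs_symmetric intro: rtrancl_into_rtrancl\<close>)
      then show ?thesis by simp
    qed
    show "(u, v) \<in> reach (parcs Q) {z}"
      if z: "z \<in> pverts G" and uv: "(u, v) \<in> parcs G" "u \<noteq> z" "v \<noteq> z"
        and ru: "(r, u) \<notin> reach (parcs Q) {z}" and rv: "(r, v) \<notin> reach (parcs Q) {z}" for z u v
    proof (rule ccontr)
      assume n: "\<not> ?thesis"
      \<comment> \<open>The component of a vertex off \<open>z\<close> is a branch if it misses the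
        root. The edge from \<open>u\<close> to \<open>v\<close> would join two different
        branches.\<close>
      let ?B = "\<lambda>w. {x. (w, x) \<in> reach (parcs Q) {z}}"
      have B: "?B w \<in> branches Q r z"
        if w: "w \<in> pverts G" "w \<noteq> z" "(r, w) \<notin> reach (parcs Q) {z}" for w
      proof -
        have in_V: "x \<in> pverts G \<and> x \<noteq> z" if "x \<in> ?B w" for x
        proof -
          have "(w, x) \<in> reach (parcs Q) {z}" using that by simp
          then show ?thesis by (induction rule: reach_induct) (use w QV in auto)
        qed
        have "?B w \<in> pre_digraph.sccs_verts (with_proj Q \<restriction> (pverts Q - {z}))"
          unfolding pre_digraph.sccs_verts_def V
        proof (intro CollectI conjI ballI allI impI)
          have "w \<in> ?B w" by simp
          then show "?B w \<noteq> {}" by blast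
        next
          fix s t assume s: "s \<in> ?B w" "t \<in> ?B w"
          then have "(s, t) \<in> reach (parcs Q) {z}"
            using reach_trans[OF reach_sym[OF symQ]] by blast
          then show "s \<rightarrow>\<^sup>*\<^bsub>with_proj Q \<restriction> (pverts G - {z})\<^esub> t"
            using reachable_induce[OF QV refl] in_V[OF s(1)] by blast
        next
          fix s t assume s: "s \<in> ?B w" "t \<notin> ?B w"
          then have "(s, t) \<notin> reach (parcs Q) {z}" using reach_trans[of w s] by blast
          then show "\<not> s \<rightarrow>\<^sup>*\<^bsub>with_proj Q \<restriction> (pverts G - {z})\<^esub> t \<or>
              \<not> t \<rightarrow>\<^sup>*\<^bsub>with_proj Q \<restriction> (pverts G - {z})\<^esub> s"
            using reachable_induce[OF QV refl] in_V[OF s(1)] by blast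
        qed
        moreover have "r \<notin> ?B w" using w(3) reach_sym[OF symQ] by blast
        ultimately show ?thesis by (simp add: branches_def)
      qed
      have V': "u \<in> pverts G" "v \<in> pverts G" using uv G.in_arcsD1 G.in_arcsD2 by auto
      have "?B u \<noteq> ?B v" using n reach_refl[of v "parcs Q" "{z}"] by (metis mem_Collect_eq)
      from D[unfolded dfs_tree_def, THEN conjunct2, THEN conjunct2, rule_format,
          OF z B[OF V'(1) uv(2) ru] B[OF V'(2) uv(3) rv] this]
      show False using uv(1) by (metis mem_Collect_eq reach_refl)
    qed
  qed
qed

text \<open>If at most one tree edge is contractible, \<open>dense_dfs\<close> holds with the
  contractible edges as \<open>K\<close>, which is impossible.\<close>

theorem theorem3:
  fixes G Q :: "'a pair_pre_digraph" and r :: 'a and k :: nat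
  assumes "k > 3"
    and "pair_graph G"
    and "k_connected k G"
    and "real (min_degree G) \<ge> 3 / 2 * real k - 3 / 2"
    and "dfs_tree Q r G"
  shows "card {e \<in> uedges Q. k_contractible k G e} \<ge> 2"
proof (rule ccontr)
  assume few: "\<not> ?thesis"
  interpret G: pair_graph G by fact
  note Q = dfs_relation_of_dfs_tree[OF assms(2,5)]
  interpret dfs_relation "pverts G" "parcs G" "parcs Q" r by (rule Q(1))
  let ?S = "{e \<in> uedges Q. k_contractible k G e}"
  have "uedges Q \<subseteq> Pow (pverts G)" using Q_V by (auto simp: uedges_def)
  then have "finite ?S" using G.pair_finite_verts by (intro finite_subset[of ?S "Pow (pverts G)"]) auto
  then have one: "e = e'" if "e \<in> ?S" "e' \<in> ?S" for e e'
    using few that card_le_Suc0_iff_eq[of ?S] by auto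
  have degree: "3 * k \<le> 2 * card (parcs G `` {v}) + 3" if v: "v \<in> pverts G" for v
  proof -
    have "min_degree G \<le> card (parcs G `` {v})"
      unfolding min_degree_def using G.pair_finite_verts v
      by (intro Min_le) (auto simp flip: out_degree_eq_card_Image)
    then show ?thesis using assms(4) by linarith
  qed
  \<comment> \<open>The degree of the root gives at least (3k - 1)/2 vertices, which exceeds k + 1
    as k > 3. The graph therefore keeps more than k vertices after a contraction.\<close>
  have big: "k + 1 < card (pverts G)"
  proof -
    have "parcs G `` {r} \<subseteq> pverts G - {r}" using G.in_arcsD2 G.no_loops' by fast
    then have "card (parcs G `` {r}) \<le> card (pverts G - {r})"
      using G.pair_finite_verts by (intro card_mono) auto
    also have "\<dots> = card (pverts G) - 1" using r_V by simp
    finally show ?thesis using degree[OF r_V] assms(1) by linarith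
  qed
  interpret dense_kconn "pverts G" "parcs G" k
  proof
    show "finite (pverts G)" by (rule G.pair_finite_verts)
    show "parcs G \<subseteq> pverts G \<times> pverts G" by (rule E_in_V)
    show "sym (parcs G)" using G.arcs_symmetric by (auto intro: symI)
    show "irrefl (parcs G)" using G.no_loops' by (auto simp: irrefl_def)
  qed (use nbhd_ge_of_k_connected[OF assms(2,3)] degree assms(1) in auto)
  interpret dense_dfs "pverts G" "parcs G" "parcs Q" k r "{e. k_contractible k G e}"
  proof
    show "parcs Q \<subseteq> parcs G" by (rule Q(2))
    show "{x, y} = {x', y'}"
      if "(x, y) \<in> parcs Q" "{x, y} \<in> {e. k_contractible k G e}" "(x', y') \<in> parcs Q"
        "{x', y'} \<in> {e. k_contractible k G e}" for x y x' y'
      by (rule one) (use that in \<open>auto simp: uedges_def\<close>)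
    show "\<exists>F. fragment F \<and> x \<in> N F \<and> y \<in> N F"
      if xy: "(x, y) \<in> parcs Q" "{x, y} \<notin> {e. k_contractible k G e}" for x y
    proof -
      have xyG: "(x, y) \<in> parcs G" using xy Q(2) by blast
      then have "\<not> k_connected k (contract G {x, y})"
        using xy(2) by (auto simp: k_contractible_def uedges_def)
      then obtain F where "F \<subseteq> pverts G" "F \<noteq> {}" "F \<union> N F \<noteq> pverts G" "card (N F) = k"
        "x \<in> N F" "y \<in> N F"
        by (rule not_contractible_separator[OF assms(2,3) big xyG])
      then show ?thesis unfolding fragment_def by blast
    qed
  qed
  show False by (rule contradiction)
qed

end
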